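(* Let $M$ and $N$ be unions of $9$ pairwise disjoint circles in $S^2$ such that: (i) the dual graph $G(S^2,M)$ is the tree with $9$ edges consisting of two adjacent vertices $B$ and $C$, each of degree $5$, where $B$ is adjacent to $C$ and to four leaves, and $C$ is adjacent to $B$ and to four other leaves; (ii) the dual graph $G(S^2,N)$ is the tree with $9$ edges consisting of three paths of length $3$ glued together at one common endpoint (and otherwise disjoint). Then there are no two spheres $S,S'$ in $\mathbb{R}^3$ such that the intersection $S\cap S'$ is transversal, is a union of $9$ disjoint circles, is situated in $S$ as $M$ in $S^2$, and is situated in $S'$ as $N$ in $S^2$.
   Context: Everything is in the piecewise-linear (PL) category. A circle is a closed broken line (polygon) without self-intersections; a sphere is a 2-dimensional polyhedral surface PL homeomorphic to $S^2$; $S^2$ itself carries its standard PL structure. If $M'$ is a union of disjoint circles in a sphere $S$ and $M$ is a union of the same number of disjoint circles in a sphere $T$, then $M'$ is situated in $S$ as $M$ in $T$ if there is a homeomorphism $f:S\to T$ with $f(M')=M$. For a union $M$ of disjoint circles in $S^2$, the dual graph $G(S^2,M)$ has as vertices the connected components of $S^2-M$; two vertices are joined by an edge if the corresponding components are neighbors, i.e. share a boundary circle. It is a tree whose edges correspond bijectively to the circles of $M$, and it determines $M$ up to a homeomorphism of $S^2$. *)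

theory Defs
  imports "HOL-Analysis.Analysis"
begin

section \<open>Piecewise-linear maps between compact polyhedra\<close>

text \<open>A map is PL on a compact polyhedron if it is affine on every simplex of some finite
  simplicial complex triangulating that polyhedron; continuity is then automatic. In particular,
  \<open>pl_on P f\<close> implies that \<open>P\<close> is a compact polyhedron.\<close>

definition affine_map_on :: "'a::real_vector set \<Rightarrow> ('a \<Rightarrow> 'b::real_vector) \<Rightarrow> bool" where
  "affine_map_on A f \<longleftrightarrow> (\<exists>g c. linear g \<and> (\<forall>x\<in>A. f x = g x + c))"

definition pl_on :: "'a::euclidean_space set \<Rightarrow> ('a \<Rightarrow> 'b::euclidean_space) \<Rightarrow> bool" where
  "pl_on P f \<longleftrightarrow>
     (\<exists>K. simplicial_complex K \<and> \<Union>K = P \<and> (\<forall>\<sigma>\<in>K. affine_map_on \<sigma> f))"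

definition pl_homeomorphism ::
  "'a::euclidean_space set \<Rightarrow> 'b::euclidean_space set \<Rightarrow> ('a \<Rightarrow> 'b) \<Rightarrow> ('b \<Rightarrow> 'a) \<Rightarrow> bool" where
  "pl_homeomorphism P Q f g \<longleftrightarrow> homeomorphism P Q f g \<and> pl_on P f \<and> pl_on Q g"

definition pl_homeomorphic :: "'a::euclidean_space set \<Rightarrow> 'b::euclidean_space set \<Rightarrow> bool" where
  "pl_homeomorphic P Q \<longleftrightarrow> (\<exists>f g. pl_homeomorphism P Q f g)"

section \<open>Spheres and circles\<close>

text \<open>The 2-sphere with its standard PL structure, realised as the boundary of a cube.\<close>

definition std_cube :: "(real^3) set" where
  "std_cube = cbox (- 1) 1"

definition S2 :: "(real^3) set" where
  "S2 = frontier std_cube"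

definition pl_sphere :: "(real^3) set \<Rightarrow> bool" where
  "pl_sphere S \<longleftrightarrow> pl_homeomorphic S S2"

text \<open>A closed broken line with vertices \<open>v\<^sub>0, \<dots>, v\<^sub>n\<^sub>-\<^sub>1\<close>. The last condition says that two
  different edges meet exactly in their common endpoints, if any.\<close>

definition polygon_edge :: "'a::real_vector list \<Rightarrow> nat \<Rightarrow> 'a set" where
  "polygon_edge vs i = closed_segment (vs ! i) (vs ! (Suc i mod length vs))"

definition polygon_edge_ends :: "'a list \<Rightarrow> nat \<Rightarrow> 'a set" where
  "polygon_edge_ends vs i = {vs ! i, vs ! (Suc i mod length vs)}"

definition pl_circle :: "'a::real_vector set \<Rightarrow> bool" where
  "pl_circle C \<longleftrightarrow>
     (\<exists>vs. length vs \<ge> 3 \<and> distinct vs \<and>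
           C = (\<Union>i<length vs. polygon_edge vs i) \<and>
           (\<forall>i<length vs. \<forall>j<length vs. i \<noteq> j \<longrightarrow>
              polygon_edge vs i \<inter> polygon_edge vs j
                = polygon_edge_ends vs i \<inter> polygon_edge_ends vs j))"

definition union_of_disjoint_circles :: "nat \<Rightarrow> 'a::real_vector set \<Rightarrow> bool" where
  "union_of_disjoint_circles n M \<longleftrightarrow>
     (\<exists>\<C>. finite \<C> \<and> card \<C> = n \<and> (\<forall>C\<in>\<C>. pl_circle C) \<and> pairwise disjnt \<C> \<and> M = \<Union>\<C>)"

definition situated_as ::
  "(real^3) set \<Rightarrow> (real^3) set \<Rightarrow> (real^3) set \<Rightarrow> (real^3) set \<Rightarrow> bool" where
  "situated_as M' S M T \<longleftrightarrow> (\<exists>f g. pl_homeomorphism S T f g \<and> f ` M' = M)"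

text \<open>Local PL transversality of two surfaces in 3-space: near every common point, the pair is PL
  equivalent to a pair of coordinate planes meeting in a line.\<close>

definition transversal :: "(real^3) set \<Rightarrow> (real^3) set \<Rightarrow> bool" where
  "transversal S S' \<longleftrightarrow>
     (\<forall>p \<in> S \<inter> S'. \<exists>U h k.
        p \<in> interior U \<and> pl_homeomorphism U std_cube h k \<and> h p = 0 \<and>
        h ` (S \<inter> U) = {x \<in> std_cube. x $ 1 = 0} \<and>
        h ` (S' \<inter> U) = {x \<in> std_cube. x $ 2 = 0})"

section \<open>Graphs and dual graphs\<close>

text \<open>A simple graph is given by its vertex set and its set of edges, each edge being the
  two-element set of its ends.\<close>

type_synonym 'a graph = "'a set \<times> 'a set set"

definition graph_isomorphic :: "'a graph \<Rightarrow> 'b graph \<Rightarrow> bool" where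
  "graph_isomorphic G H \<longleftrightarrow>
     (\<exists>\<phi>. bij_betw \<phi> (fst G) (fst H) \<and>
          (\<forall>u\<in>fst G. \<forall>v\<in>fst G. {u, v} \<in> snd G \<longleftrightarrow> {\<phi> u, \<phi> v} \<in> snd H))"

text \<open>If \<open>M\<close> is a disjoint union of finitely many circles, these circles are the connected
  components of \<open>M\<close>. A circle missing the open region \<open>U\<close> lies on its boundary iff it is contained
  in \<open>closure U\<close>; for closed \<open>S\<close> the closure in the whole space is the one in \<open>S\<close>.\<close>

definition neighbors :: "(real^3) set \<Rightarrow> (real^3) set \<Rightarrow> (real^3) set \<Rightarrow> bool" where
  "neighbors M U V \<longleftrightarrow>
     U \<noteq> V \<and> (\<exists>C \<in> components M. C \<subseteq> closure U \<and> C \<subseteq> closure V)"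

definition dual_graph :: "(real^3) set \<Rightarrow> (real^3) set \<Rightarrow> (real^3) set graph" where
  "dual_graph S M =
     (components (S - M),
      {{U, V} | U V. U \<in> components (S - M) \<and> V \<in> components (S - M) \<and> neighbors M U V})"

text \<open>The vertices \<open>B\<close> and \<open>C\<close> are \<open>0\<close> and \<open>1\<close>; the leaves at \<open>B\<close> are \<open>2, \<dots>, 5\<close> and those at
  \<open>C\<close> are \<open>6, \<dots>, 9\<close>.\<close>

definition double_star_tree :: "nat graph" where
  "double_star_tree =
     ({0..9}, {{0, 1}} \<union> {{0, i} | i. i \<in> {2..5}} \<union> {{1, i} | i. i \<in> {6..9}})"

text \<open>Three paths of length 3 starting at the common endpoint \<open>0\<close>.\<close>

definition three_paths_tree :: "nat graph" where
  "three_paths_tree =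
     ({0..9}, {{0, 1}, {1, 2}, {2, 3}} \<union> {{0, 4}, {4, 5}, {5, 6}} \<union> {{0, 7}, {7, 8}, {8, 9}})"

end

theory Submission
  imports Defs
begin

text \<open>Two spheres \<open>S\<close>, \<open>T\<close> meet transversally in nine circles; the circles are the edges of both dual
trees. Consider a leaf \<open>D\<close> of the tree of \<open>S\<close>. It is an open disc whose boundary is one circle \<open>c\<close>,
and \<open>D\<close> lies in one component \<open>\<Omega>\<close> of the complement of \<open>T\<close>. As a properly embedded disc it cuts
\<open>\<Omega>\<close> into two pieces, one touching each of the two parts into which \<open>c\<close> cuts \<open>T\<close>. Any other region
\<open>F\<close> of \<open>S\<close> inside \<open>\<Omega>\<close> is connected and misses \<open>D\<close>, so all its boundary circles lie in the same part of
\<open>T\<close>: removing the edge \<open>c\<close> from the tree of \<open>T\<close> does not separate the edges at \<open>F\<close> from each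
other (\<open>leaf_disc_does_not_separate\<close>). Two regions of \<open>S\<close> lie on the same side of \<open>T\<close> whenever they
have a common neighbor, because crossing a circle of the intersection within \<open>S\<close> means crossing
\<open>T\<close> (\<open>regions_opposite\<close>).

For the double star with centers \<open>0\<close> and \<open>1\<close> this says: an edge at \<open>1\<close> other than the central one
never separates, in the other tree, two edges at \<open>0\<close>, and symmetrically. But the edges of the
three legs cannot be distributed in this way (\<open>no_unlinked_coloring_of_legs\<close>). A leg without the central edge
must be of a single kind, as its inner edges would otherwise separate an outer edge of the other
kind from the central edge. There are only five edges at each center, so one such leg belongs
to \<open>0\<close> and the other to \<open>1\<close>. In the third leg the central edge must then come first, and the two
edges after it must be of one kind, which again gives six edges at one center.

That the disc cuts \<open>\<Omega>\<close> is a statement about separation in 3-space. It comes from a theorem of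
Janiszewski type (\<open>connected_component_Un_retract\<close>): if neither of the compact sets \<open>A\<close>, \<open>B\<close> separates two points
and \<open>A \<inter> B\<close> is an absolute retract, then \<open>A \<union> B\<close> does not separate them. Apply it to the two
parts of \<open>T\<close>, each united with the closed disc: their union contains \<open>T\<close> and so separates its two sides,
and their intersection is the closed disc. That it is an absolute
retract (\<open>AR_closed_disc_in_sphere\<close>) follows from the Jordan curve theorem and an extension theorem
for maps into the circle. The PL structure enters through two facts: each circle is a simple closed
curve, and the two surfaces look like crossing planes near their intersection.\<close>

section \<open>A separation theorem of Janiszewski type\<close>

text \<open>The extensions \<open>F1\<close>, \<open>F2\<close> live on the whole space, so the arguments can be pushed along the straight
lines from \<open>x\<close> to \<open>r x\<close>. The two pushes agree on \<open>A \<inter> B\<close>, where \<open>r\<close> does not move points, and end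
at a map that factors through \<open>r\<close> and \<open>F1\<close>, hence through a contractible space.\<close>

lemma null_homotopic_Un_retract:
  fixes A B :: "'a::euclidean_space set" and S :: "'b::real_normed_vector set"
  assumes "closed A" "closed B" and r: "retraction UNIV (A \<inter> B) r"
    and F1: "continuous_on UNIV F1" "range F1 \<subseteq> S" "\<And>x. x \<in> A \<Longrightarrow> F1 x = f x"
    and F2: "continuous_on UNIV F2" "range F2 \<subseteq> S" "\<And>x. x \<in> B \<Longrightarrow> F2 x = f x"
  shows "\<exists>c. homotopic_with_canon (\<lambda>x. True) (A \<union> B) S f (\<lambda>x. c)"
proof -
  have contr: "continuous_on X r" for X
    using r continuous_on_subset retraction_def by blast
  have rim: "r x \<in> A" "r x \<in> B" for x
    using r by (auto simp: retraction_def)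
  have rid: "r x = x" if "x \<in> A" "x \<in> B" for x
    using r that by (auto simp: retraction_def)
  define m where "m = (\<lambda>z::real \<times> 'a. (1 - fst z) *\<^sub>R snd z + fst z *\<^sub>R r (snd z))"
  define h where "h = (\<lambda>z. if z \<in> {0..1} \<times> A then F1 (m z) else F2 (m z))"
  have contm: "continuous_on X m" for X
    unfolding m_def by (intro continuous_intros continuous_on_compose2[OF contr[of UNIV]]) auto
  have contF: "continuous_on X (\<lambda>z. F1 (m z))" "continuous_on X (\<lambda>z. F2 (m z))" for X
    by (rule continuous_on_compose2[OF F1(1) contm] continuous_on_compose2[OF F2(1) contm]; simp)+
  have mid: "m (t, x) = x" if "x \<in> A" "x \<in> B" for t x
    using rid[OF that] by (simp add: m_def algebra_simps)
  have "continuous_on ({0..1} \<times> A \<union> {0..1} \<times> B) h"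
    unfolding h_def
    by (rule continuous_on_cases)
       (use assms(1,2) F1(3) F2(3) in \<open>auto intro!: closed_Times contF simp: mid\<close>)
  then have conth: "continuous_on ({0..1} \<times> (A \<union> B)) h"
    by (simp add: Sigma_Un_distrib2 Sigma_Un_distrib1 Times_Un_distrib1)
  have "homotopic_with_canon (\<lambda>x. True) (A \<union> B) S f (F1 \<circ> r)"
  proof -
    have 0: "h (0, x) = f x" if "x \<in> A \<union> B" for x
      using that F1(3) F2(3) by (auto simp: h_def m_def)
    have 1: "h (1, x) = (F1 \<circ> r) x" if "x \<in> A \<union> B" for x
      using that F1(3)[OF rim(1)] F2(3)[OF rim(2)] by (auto simp: h_def m_def)
    have 2: "h ` ({0..1} \<times> (A \<union> B)) \<subseteq> S"
      using F1(2) F2(2) by (auto simp: h_def)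
    show ?thesis
      using conth 0 1 2
      by (subst homotopic_with) (auto simp: continuous_map_subtopology_eu prod_topology_subtopology_eu intro!: exI[of _ h])
  qed
  moreover obtain c where "homotopic_with_canon (\<lambda>x. True) (A \<union> B) S (F1 \<circ> r) (\<lambda>x. c)"
    by (rule nullhomotopic_through_contractible[of "A \<union> B" r UNIV F1 S])
       (use contr F1 in \<open>auto simp: contractible_UNIV\<close>)
  ultimately show ?thesis
    using homotopic_with_trans by blast
qed

text \<open>By Borsuk, \<open>a\<close> is in an unbounded component of the complement of a compact set iff the radial
projection from \<open>a\<close> onto the unit sphere is inessential on that set, i.e. extends to the whole space.\<close>

lemma unbounded_component_Un_retract:
  fixes A B :: "'a::euclidean_space set"
  assumes "compact A" "compact B" and r: "(A \<inter> B) retract_of UNIV" and "a \<notin> A" "a \<notin> B"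
    and ubA: "\<not> bounded (connected_component_set (- A) a)"
    and ubB: "\<not> bounded (connected_component_set (- B) a)"
  shows "\<not> bounded (connected_component_set (- (A \<union> B)) a)"
proof -
  let ?f = "\<lambda>x. inverse (norm (x - a)) *\<^sub>R (x - a)"
  have ext: "\<exists>g. continuous_on UNIV g \<and> range g \<subseteq> sphere 0 1 \<and> (\<forall>x\<in>K. g x = ?f x)"
    if "compact K" "K \<noteq> {}" "a \<notin> K" "\<not> bounded (connected_component_set (- K) a)" for K
  proof -
    have "continuous_on K ?f"
      using that by (intro continuous_intros) auto
    moreover have "?f ` K \<subseteq> sphere 0 1"
      using that by (auto intro!: left_inverse)
    moreover have "\<exists>c. homotopic_with_canon (\<lambda>x. True) K (sphere 0 1) ?f (\<lambda>x. c)"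
      using Borsuk_map_essential_bounded_component that by blast
    ultimately show ?thesis
      using nullhomotopic_into_sphere_extension[of K ?f 0 1] that compact_imp_closed by blast
  qed
  have ne: "A \<inter> B \<noteq> {}"
    using r by auto
  obtain F1 where "continuous_on UNIV F1" "range F1 \<subseteq> sphere 0 1" "\<And>x. x \<in> A \<Longrightarrow> F1 x = ?f x"
    using ext[of A] assms ne by blast
  moreover obtain F2 where "continuous_on UNIV F2" "range F2 \<subseteq> sphere 0 1" "\<And>x. x \<in> B \<Longrightarrow> F2 x = ?f x"
    using ext[of B] assms ne by blast
  moreover obtain \<rho> where "retraction UNIV (A \<inter> B) \<rho>"
    using r by (auto simp: retract_of_def)
  ultimately have "\<exists>c. homotopic_with_canon (\<lambda>x. True) (A \<union> B) (sphere 0 1) ?f (\<lambda>x. c)"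
    using null_homotopic_Un_retract[of A B \<rho> F1 "sphere 0 1" ?f F2] assms compact_imp_closed by blast
  then show ?thesis
    using Borsuk_map_essential_bounded_component[of "A \<union> B" a] assms by (simp add: compact_Un)
qed

definition inversion :: "'a::real_inner \<Rightarrow> 'a" where
  "inversion x = x /\<^sub>R (norm x)\<^sup>2"

lemma inversion_inversion [simp]: "inversion (inversion x) = x"
  by (cases "x = 0") (auto simp: inversion_def power2_eq_square field_simps)

lemma inversion_eq_0 [simp]: "inversion x = 0 \<longleftrightarrow> x = 0"
  by (auto simp: inversion_def)

lemma norm_inversion: "norm (inversion x) = inverse (norm x)"
  by (cases "x = 0") (auto simp: inversion_def power2_eq_square field_simps)

lemma continuous_on_inversion: "0 \<notin> X \<Longrightarrow> continuous_on X inversion"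
  unfolding inversion_def by (intro continuous_intros) auto

lemma inversion_Compl: "inversion ` (- X) = - (inversion ` X)"
  by (rule bij_image_Compl_eq) (rule bijI', metis inversion_inversion, metis inversion_inversion)

text \<open>Inversion exchanges 0 with infinity. It thereby reduces the question whether two points are
separated to the question whether one point is separated from infinity, to which Borsuk's criterion applies.\<close>

lemma connected_component_0_iff_unbounded_inversion:
  fixes K :: "'a::euclidean_space set"
  assumes "compact K" "0 \<notin> K" "a \<notin> K" "a \<noteq> 0" and DIM: "2 \<le> DIM('a)"
  shows "connected_component (- K) a 0 \<longleftrightarrow>
         \<not> bounded (connected_component_set (- (inversion ` K)) (inversion a))"
proof
  assume "connected_component (- K) a 0"
  define C where "C = connected_component_set (- K) a"
  have C: "open C" "connected C" "a \<in> C" "0 \<in> C" "C \<subseteq> - K"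
    using assms \<open>connected_component (- K) a 0\<close> connected_component_subset[of "- K" a]
    by (auto simp: C_def compact_imp_closed open_Compl open_connected_component connected_component_refl)
  have con: "connected (inversion ` (C - {0}))"
    using C by (intro connected_continuous_image continuous_on_inversion connected_open_delete DIM) auto
  have sub: "inversion ` (C - {0}) \<subseteq> connected_component_set (- (inversion ` K)) (inversion a)"
    using C assms con by (intro connected_component_maximal) (auto simp: inversion_Compl[symmetric])
  have "\<not> bounded (inversion ` (C - {0}))"
  proof
    assume "bounded (inversion ` (C - {0}))"
    then obtain b where b: "b > 0" "\<And>x. x \<in> C - {0} \<Longrightarrow> norm (inversion x) \<le> b"
      by (auto simp: bounded_pos)
    obtain e where e: "e > 0" "ball 0 e \<subseteq> C"
      using C openE by blast
    \<comment> \<open>A point of \<open>C\<close> so close to 0 that its image has norm at least \<open>2 * b\<close>.\<close>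
    obtain u :: 'a where u: "norm u = min (e/2) (inverse (2*b))"
      using vector_choose_size[of "min (e/2) (inverse (2*b))"] e b by auto
    have "norm u > 0" "norm u < e" 
      using u e b by auto
    then have "inverse (norm u) \<le> b"
      using b(2)[of u] e by (auto simp: norm_inversion)
    moreover have "inverse (norm u) \<ge> 2 * b"
      using u b \<open>norm u > 0\<close> by (metis inverse_inverse_eq le_imp_inverse_le min.cobounded2)
    ultimately show False using b by auto
  qed
  then show "\<not> bounded (connected_component_set (- (inversion ` K)) (inversion a))"
    using sub bounded_subset by blast
next
  assume ub: "\<not> bounded (connected_component_set (- (inversion ` K)) (inversion a))"
  define C where "C = connected_component_set (- (inversion ` K)) (inversion a)"
  have "compact (inversion ` K)"
    using assms by (intro compact_continuous_image continuous_on_inversion) auto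
  moreover have "inversion a \<notin> inversion ` K"
    using assms by (metis image_iff inversion_inversion)
  ultimately have C: "open C" "connected C" "inversion a \<in> C" "C \<subseteq> - (inversion ` K)"
    using assms connected_component_subset[of "- (inversion ` K)" "inversion a"]
    by (auto simp: C_def compact_imp_closed open_Compl open_connected_component connected_component_refl)
  have con: "connected (inversion ` (C - {0}))"
    using C by (intro connected_continuous_image continuous_on_inversion connected_open_delete DIM) auto
  have "0 \<in> closure (inversion ` (C - {0}))"
    unfolding closure_approachable
  proof (intro allI impI)
    fix e :: real assume "e > 0"
    then obtain x where "x \<in> C" "norm x > inverse e"
      using ub unfolding C_def[symmetric] bounded_iff by (meson linorder_not_le)
    then have "norm (inversion x) < e" "x \<noteq> 0"
      using \<open>e > 0\<close> by (auto simp: norm_inversion inverse_less_imp_less)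
    then show "\<exists>y\<in>inversion ` (C - {0}). dist y 0 < e"
      using \<open>x \<in> C\<close> by auto
  qed
  then have "insert 0 (inversion ` (C - {0})) \<subseteq> closure (inversion ` (C - {0}))"
    using closure_subset[of "inversion ` (C - {0})"] by (rule insert_subsetI)
  then have "connected (insert 0 (inversion ` (C - {0})))"
    by (rule connected_intermediate_closure[OF con subset_insertI])
  moreover have "insert 0 (inversion ` (C - {0})) \<subseteq> - K"
  proof -
    have "inversion x \<notin> K" if "x \<in> C" for x
      using that C(4) by (metis ComplD imageI inversion_inversion subsetD)
    then show ?thesis using assms by auto
  qed
  moreover have "a \<in> inversion ` (C - {0})"
    using C assms by (metis DiffI image_eqI inversion_eq_0 inversion_inversion singletonD)
  ultimately show "connected_component (- K) a 0"
    unfolding connected_component_def by blast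
qed

text \<open>Translating \<open>b\<close> to 0 and inverting turns the claim into the case where \<open>b\<close> is at infinity. The
intersection remains an absolute retract, as this is a topological property.\<close>

theorem connected_component_Un_retract:
  fixes A B :: "'a::euclidean_space set"
  assumes "compact A" "compact B" and r: "(A \<inter> B) retract_of UNIV" and DIM: "2 \<le> DIM('a)"
    and A: "connected_component (- A) a b" and B: "connected_component (- B) a b"
  shows "connected_component (- (A \<union> B)) a b"
proof (cases "a = b")
  case True
  then show ?thesis
    using A B connected_component_in by (metis ComplD ComplI UnE connected_component_refl)
next
  case False
  let ?t = "\<lambda>x. x - b"
  have ab: "a \<notin> A" "a \<notin> B" "b \<notin> A" "b \<notin> B"
    using A B connected_component_in by blast+
  have shift: "connected_component (- (?t ` K)) (a - b) 0 \<longleftrightarrow> connected_component (- K) a b" for K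
  proof -
    have "connected_component (- (?t ` K)) (a - b) 0" if "connected_component (- K) a b"
    proof -
      from that obtain T where T: "connected T" "T \<subseteq> - K" "a \<in> T" "b \<in> T"
        by (auto simp: connected_component_def)
      have "connected (?t ` T)" using T by (intro connected_continuous_image continuous_intros)
      moreover have "?t ` T \<subseteq> - (?t ` K)" using T by auto
      moreover have "a - b \<in> ?t ` T" "0 \<in> ?t ` T" using T by force+
      ultimately show ?thesis unfolding connected_component_def by blast
    qed
    moreover have "connected_component (- K) a b" if "connected_component (- (?t ` K)) (a - b) 0"
    proof -
      from that obtain T where T: "connected T" "T \<subseteq> - (?t ` K)" "a - b \<in> T" "0 \<in> T"
        by (auto simp: connected_component_def)
      have "connected ((\<lambda>x. x + b) ` T)" using T by (intro connected_continuous_image continuous_intros)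
      moreover have "(\<lambda>x. x + b) ` T \<subseteq> - K" using T by force
      moreover have "a \<in> (\<lambda>x. x + b) ` T" "b \<in> (\<lambda>x. x + b) ` T" using T by force+
      ultimately show ?thesis unfolding connected_component_def by blast
    qed
    ultimately show ?thesis by blast
  qed
  let ?u = "\<lambda>x. inversion (x - b)"
  have inv: "connected_component (- K) a b \<longleftrightarrow>
      \<not> bounded (connected_component_set (- (?u ` K)) (?u a))"
    if "compact K" "a \<notin> K" "b \<notin> K" for K
  proof -
    have "compact (?t ` K)" using that by (intro compact_continuous_image continuous_intros)
    moreover have "inversion ` ?t ` K = ?u ` K" by auto
    moreover have "0 \<notin> ?t ` K" "a - b \<notin> ?t ` K" using that by auto
    ultimately show ?thesis
      using connected_component_0_iff_unbounded_inversion[of "?t ` K" "a - b"] that False DIM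
      by (auto simp: shift)
  qed
  have injon: "inj ?u"
    by (rule injI) (metis inversion_inversion diff_add_cancel)
  have contu: "continuous_on X ?u" if "b \<notin> X" for X
    using that by (intro continuous_on_compose2[OF continuous_on_inversion[of "?t ` X"]] continuous_intros) auto
  have comp: "compact (?u ` A)" "compact (?u ` B)"
    using assms ab by (auto intro!: compact_continuous_image contu)
  have hom: "A \<inter> B homeomorphic ?u ` (A \<inter> B)"
    using injon assms ab inj_on_subset
    by (intro homeomorphic_compact[where f = ?u] compact_Int contu) auto
  have "AR (?u ` (A \<inter> B))"
    using r hom homeomorphic_AR_iff_AR retract_of_UNIV by blast
  then have "(?u ` A \<inter> ?u ` B) retract_of UNIV"
    using comp by (simp add: retract_of_UNIV image_Int[OF injon] closed_Int compact_imp_closed)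
  moreover have "?u a \<notin> ?u ` A" "?u a \<notin> ?u ` B"
    using ab inj_image_mem_iff[OF injon] by auto
  ultimately have "\<not> bounded (connected_component_set (- (?u ` A \<union> ?u ` B)) (?u a))"
    using unbounded_component_Un_retract[OF comp] inv[of A] inv[of B] A B assms ab by blast
  then show ?thesis
    using inv[of "A \<union> B"] ab assms by (simp add: image_Un compact_Un)
qed

section \<open>Closed discs in a sphere are absolute retracts\<close>

text \<open>Only a retraction of the closed outside onto the curve \<open>c\<close> is needed, since the identity on the inside extends
it to a retraction of the plane. A homeomorphism of \<open>c\<close> with the unit circle extends to the
plane without one point \<open>p\<close> of each bounded complementary component; by the Jordan curve theorem
\<open>p\<close> is a single point inside. Composing with the inverse homeomorphism gives the retraction.\<close>

lemma AR_closed_inside_Jordan_curve: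
  fixes \<gamma> :: "real \<Rightarrow> complex"
  assumes "simple_path \<gamma>" and loop: "pathfinish \<gamma> = pathstart \<gamma>"
  shows "AR (inside (path_image \<gamma>) \<union> path_image \<gamma>)"
proof -
  let ?c = "path_image \<gamma>"
  let ?I = "inside ?c" and ?O = "outside ?c"
  have J: "?I \<noteq> {}" "connected ?I" "connected ?O" "\<not> bounded ?O" "?I \<union> ?O = - ?c" "open ?I"
    using Jordan_inside_outside[OF assms] by simp_all
  obtain p where p: "p \<in> ?I" using J by blast
  have "compact ?c"
    using assms by (simp add: compact_simple_path_image)
  obtain h k where hk: "homeomorphism ?c (sphere 0 (1::real)) h (k :: complex \<Rightarrow> complex)"
    using homeomorphic_simple_path_image_circle[OF assms, of 1 0] unfolding homeomorphic_def by auto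
  then have hk': "continuous_on ?c h" "h \<in> ?c \<rightarrow> sphere 0 1"
    by (auto simp: homeomorphism_def)
  have bc: "C \<inter> {p} \<noteq> {}" if "C \<in> components (UNIV - ?c)" "bounded C" for C
  proof -
    have "C \<inter> ?I \<noteq> {}"
    proof
      assume "C \<inter> ?I = {}"
      moreover have "C \<noteq> {}" "C \<subseteq> - ?c"
        using that in_components_nonempty[of C] in_components_subset[of C "UNIV - ?c"] by auto
      ultimately have "C \<inter> ?O \<noteq> {}"
        using J(5) by blast
      then have "?O \<subseteq> C"
        using J(5) by (intro components_maximal[OF that(1) J(3)]) blast+
      then show False
        using that(2) J(4) bounded_subset by metis
    qed
    then have "?I \<subseteq> C"
      using J(5) by (intro components_maximal[OF that(1) J(2)]) blast+
    then show ?thesis using p by blast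
  qed
  obtain K g where K: "K \<subseteq> {p}" and contg: "continuous_on (UNIV - K) g"
    and gim: "g \<in> (UNIV - K) \<rightarrow> sphere 0 (1::real)" and gh: "\<And>x. x \<in> ?c \<Longrightarrow> g x = h x"
  proof (rule extend_map_affine_to_sphere_cofinite
      [OF \<open>compact ?c\<close> affine_UNIV subset_UNIV _ _ hk' bc])
  qed auto
  define r where "r = (\<lambda>x. if x \<in> ?I \<union> ?c then x else k (g x))"
  have KI: "- ?I \<subseteq> UNIV - K"
    using K p by auto
  have cl: "closed (?I \<union> ?c)" "closed (- ?I)"
    using closed_path_image_Un_inside[OF simple_path_imp_path[OF assms(1)]] J(6)
    by (simp_all add: Un_commute closed_Compl)
  have "continuous_on (- ?I) (\<lambda>x. k (g x))"
    using gim KI hk contg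
    by (intro continuous_on_compose2[of "sphere 0 1" k "- ?I" g] continuous_on_subset[OF contg])
       (auto simp: homeomorphism_def)
  moreover have "k (g x) = x" if "x \<in> ?c" for x
    using that gh hk by (simp add: homeomorphism_def)
  ultimately have "continuous_on ((?I \<union> ?c) \<union> - ?I) r"
    unfolding r_def using cl by (intro continuous_on_cases) auto
  moreover have "(?I \<union> ?c) \<union> - ?I = UNIV" by auto
  moreover have "r x \<in> ?I \<union> ?c" for x
  proof (cases "x \<in> ?I \<union> ?c")
    case False
    then have "g x \<in> sphere 0 1" using gim KI by auto
    then have "k (g x) \<in> ?c" using hk by (auto simp: homeomorphism_def)
    then show ?thesis using False by (simp add: r_def)
  qed (simp add: r_def)
  moreover have "\<forall>x\<in>?I \<union> ?c. r x = x"
    by (simp add: r_def)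
  ultimately have "retraction UNIV (?I \<union> ?c) r"
    unfolding retraction_def by (metis Pi_I subset_UNIV)
  then have "(?I \<union> ?c) retract_of UNIV"
    unfolding retract_of_def by blast
  then show ?thesis by (simp add: retract_of_UNIV)
qed

text \<open>Stereographic projection from a point \<open>q\<close> outside the disc turns \<open>D\<close> into a bounded component of the
complement of a Jordan curve, that is, into its inside.\<close>

lemma AR_closed_disc_in_sphere:
  fixes S :: "'a::euclidean_space set" and \<gamma> :: "real \<Rightarrow> 'a"
  assumes S: "S homeomorphic sphere (0::real^3) 1"
    and \<gamma>: "simple_path \<gamma>" "pathfinish \<gamma> = pathstart \<gamma>" "path_image \<gamma> \<subseteq> S"
    and D: "D \<in> components (S - path_image \<gamma>)" and q: "q \<in> S - path_image \<gamma> - D"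
    and clD: "closed (D \<union> path_image \<gamma>)"
  shows "AR (D \<union> path_image \<gamma>)"
proof -
  let ?c = "path_image \<gamma>"
  obtain F G where FG: "homeomorphism S (sphere (0::real^3) 1) F G"
    using S by (auto simp: homeomorphic_def)
  have Fq: "F q \<in> sphere 0 1"
    using FG q by (auto simp: homeomorphism_def)
  have dim: "aff_dim (UNIV :: (real^3) set) = 3"
    by (simp add: aff_dim_UNIV)
  have "- 1 \<le> (2::int)" "2 \<le> aff_dim (UNIV :: (real^3) set)"
    by (simp_all only: dim)
  then obtain T :: "(real^3) set" where T: "affine T" "aff_dim T = 2"
    using choose_affine_subset[OF affine_UNIV] by metis
  have "F ` (S - {q}) = sphere 0 1 - {F q}"
  proof -
    have "inj_on F S" "F ` S = sphere 0 1"
      using FG by (auto simp: homeomorphism_def intro: inj_on_inverseI)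
    then show ?thesis
      using q by (simp add: inj_on_image_set_diff[of F S S "{q}"])
  qed
  then have "homeomorphism (S - {q}) (sphere 0 1 - {F q}) F G"
    by (rule homeomorphism_of_subsets[OF FG Diff_subset Diff_subset])
  then have "S - {q} homeomorphic sphere (0::real^3) 1 - {F q}"
    unfolding homeomorphic_def by blast
  also have "sphere (0::real^3) 1 - {F q} homeomorphic T"
    using Fq T by (intro homeomorphic_punctured_sphere_affine) simp_all
  also have "T homeomorphic (UNIV :: complex set)"
    using T by (intro homeomorphic_affine_sets) (simp_all add: aff_dim_UNIV DIM_cart)
  finally obtain f g where fg: "homeomorphism (S - {q}) (UNIV :: complex set) f g"
    unfolding homeomorphic_def by blast
  have cont: "continuous_on (S - {q}) f" "continuous_on UNIV g"
    and gf: "\<And>x. x \<in> S - {q} \<Longrightarrow> g (f x) = x" and fgid: "\<And>y. f (g y) = y"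
    and gim: "\<And>y. g y \<in> S - {q}"
    using fg by (auto simp: homeomorphism_def)
  have inj: "inj_on f (S - {q})"
    by (rule inj_on_inverseI[of _ g]) (rule gf)
  have csub: "?c \<subseteq> S - {q}" and Dsub: "D \<subseteq> S - ?c"
    using q \<gamma> D in_components_subset by auto
  then have Dsub': "D \<subseteq> S - {q}" using q by auto
  have sp: "simple_path (f \<circ> \<gamma>)"
    using \<gamma>(1) csub inj cont
    by (intro simple_path_continuous_image continuous_on_subset[OF cont(1)] inj_on_subset[OF inj])
  have lp: "pathfinish (f \<circ> \<gamma>) = pathstart (f \<circ> \<gamma>)"
    using \<gamma> by (simp add: pathfinish_compose pathstart_compose)
  have pim: "path_image (f \<circ> \<gamma>) = f ` ?c"
    by (rule path_image_compose)
  have J: "connected (inside (f ` ?c))" "connected (outside (f ` ?c))" "\<not> bounded (outside (f ` ?c))"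
    "inside (f ` ?c) \<union> outside (f ` ?c) = - (f ` ?c)"
    using Jordan_inside_outside[OF sp lp] by (simp_all add: pim)
  have Dne: "D \<noteq> {}" and Dcon: "connected D"
    using D in_components_nonempty in_components_connected by auto
  have disj: "f ` D \<inter> f ` ?c = {}"
    using inj_on_image_Int[OF inj Dsub' csub] Dsub by auto
  have max: "X \<subseteq> f ` D" if X: "connected X" "X \<subseteq> - (f ` ?c)" "X \<inter> f ` D \<noteq> {}" for X
  proof -
    have "connected (g ` X)"
      using X by (intro connected_continuous_image continuous_on_subset[OF cont(2)]) auto
    moreover have "g ` X \<subseteq> S - ?c"
    proof (rule image_subsetI)
      fix x assume "x \<in> X"
      then have "x \<notin> f ` ?c" using X(2) by blast
      then have "g x \<notin> ?c" using fgid[of x] by (metis imageI)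
      then show "g x \<in> S - ?c" using gim[of x] by blast
    qed
    moreover have "D \<inter> g ` X \<noteq> {}"
    proof -
      obtain d where "d \<in> D" "f d \<in> X" using X(3) by blast
      moreover have "g (f d) = d" using gf Dsub' \<open>d \<in> D\<close> by blast
      ultimately show ?thesis by (metis disjoint_iff imageI)
    qed
    ultimately have "g ` X \<subseteq> D"
      using components_maximal D by blast
    then have "f ` g ` X \<subseteq> f ` D" by (rule image_mono)
    then show ?thesis
      by (simp add: image_image fgid)
  qed
  have "compact S"
    using homeomorphic_compactness[OF S] by simp
  then have "compact (D \<union> ?c)"
    using closed_subset[OF _ clD, of S] Dsub \<gamma>(3) closedin_compact[of S] by blast
  then have "compact (f ` (D \<union> ?c))"
    using Dsub' csub by (intro compact_continuous_image continuous_on_subset[OF cont(1)]) auto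
  then have bD: "bounded (f ` D)"
    by (intro bounded_subset[OF compact_imp_bounded[of "f ` (D \<union> ?c)"]]) auto
  have no: "f ` D \<inter> outside (f ` ?c) = {}"
  proof (rule ccontr)
    assume "f ` D \<inter> outside (f ` ?c) \<noteq> {}"
    then have "outside (f ` ?c) \<subseteq> f ` D"
      using max[OF J(2)] J(4) by blast
    then show False using bD J(3) bounded_subset by metis
  qed
  then have sub: "f ` D \<subseteq> inside (f ` ?c)"
    using J(4) disj by blast
  moreover have "inside (f ` ?c) \<subseteq> f ` D"
    using max[OF J(1)] J(4) sub Dne by blast
  ultimately have "f ` D = inside (f ` ?c)" by blast
  then have "AR (f ` (D \<union> ?c))"
    using AR_closed_inside_Jordan_curve[OF sp lp] by (simp add: pim image_Un)
  moreover have "D \<union> ?c homeomorphic f ` (D \<union> ?c)"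
    using homeomorphism_of_subsets[OF fg, of "D \<union> ?c" "f ` (D \<union> ?c)"] Dsub' csub
    by (auto simp: homeomorphic_def)
  ultimately show ?thesis
    using homeomorphic_AR_iff_AR by blast
qed

section \<open>Polygons and PL spheres\<close>

text \<open>The edges are appended one at a time: as long as the polygon has not closed up, a new edge meets the arc so far only in
its starting point.\<close>

lemma pl_circle_imp_simple_loop:
  fixes C :: "'a::euclidean_space set"
  assumes "pl_circle C"
  obtains \<gamma> where "simple_path \<gamma>" "pathfinish \<gamma> = pathstart \<gamma>" "path_image \<gamma> = C"
proof -
  obtain vs where vs: "length vs \<ge> 3" "distinct vs" "C = (\<Union>i<length vs. polygon_edge vs i)"
    and meet: "\<And>i j. i < length vs \<Longrightarrow> j < length vs \<Longrightarrow> i \<noteq> j \<Longrightarrow>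
       polygon_edge vs i \<inter> polygon_edge vs j = polygon_edge_ends vs i \<inter> polygon_edge_ends vs j"
    using assms by (auto simp: pl_circle_def)
  define n where "n = length vs - 1"
  have n: "length vs = Suc n" "n \<ge> 2" using vs(1) by (auto simp: n_def)
  have nth_ne: "vs ! i \<noteq> vs ! j" if "i \<le> n" "j \<le> n" "i \<noteq> j" for i j
    using that vs(2) n by (simp add: nth_eq_iff_index_eq)
  have edge: "polygon_edge vs i = closed_segment (vs ! i) (vs ! Suc i)"
             "polygon_edge_ends vs i = {vs ! i, vs ! Suc i}" if "i < n" for i
    using that n by (auto simp: polygon_edge_def polygon_edge_ends_def)
  have last: "polygon_edge vs n = closed_segment (vs ! n) (vs ! 0)"
             "polygon_edge_ends vs n = {vs ! n, vs ! 0}"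
    using n by (auto simp: polygon_edge_def polygon_edge_ends_def)
  have arcs: "\<exists>p. arc p \<and> pathstart p = vs ! 0 \<and> pathfinish p = vs ! k \<and>
              path_image p = (\<Union>i<k. polygon_edge vs i)" if "k \<ge> 1" "k \<le> n" for k
    using that
  proof (induction k rule: nat_induct_at_least)
    case base
    then show ?case
      using n nth_ne[of 0 1] edge(1)[of 0]
      by (intro exI[of _ "linepath (vs ! 0) (vs ! 1)"]) (simp add: arc_linepath lessThan_Suc)
  next
    case (Suc k)
    then obtain p where p: "arc p" "pathstart p = vs ! 0" "pathfinish p = vs ! k"
         "path_image p = (\<Union>i<k. polygon_edge vs i)"
      by auto
    let ?l = "linepath (vs ! k) (vs ! Suc k)"
    have "polygon_edge vs i \<inter> polygon_edge vs k \<subseteq> {vs ! k}" if "i < k" for i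
    proof -
      have "polygon_edge vs i \<inter> polygon_edge vs k = {vs ! i, vs ! Suc i} \<inter> {vs ! k, vs ! Suc k}"
        using meet[of i k] that Suc.prems n edge by auto
      then show ?thesis
        using that Suc.prems nth_ne[of i k] nth_ne[of i "Suc k"] nth_ne[of "Suc i" "Suc k"] by auto
    qed
    then have "path_image p \<inter> path_image ?l \<subseteq> {vs ! k}"
      using p(4) edge(1)[of k] Suc.prems by auto
    moreover have "arc ?l"
      using nth_ne[of k "Suc k"] Suc.prems by (simp add: arc_linepath)
    ultimately have "arc (p +++ ?l)"
      using p by (intro arc_join) auto
    moreover have "path_image (p +++ ?l) = (\<Union>i<Suc k. polygon_edge vs i)"
      using p edge(1)[of k] Suc.prems by (subst path_image_join) (auto simp: lessThan_Suc)
    ultimately show ?case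
      using p by (intro exI[of _ "p +++ ?l"]) auto
  qed
  obtain p where p: "arc p" "pathstart p = vs ! 0" "pathfinish p = vs ! n"
         "path_image p = (\<Union>i<n. polygon_edge vs i)"
    using arcs[of n] n by auto
  let ?l = "linepath (vs ! n) (vs ! 0)"
  have "polygon_edge vs i \<inter> polygon_edge vs n \<subseteq> {vs ! n, vs ! 0}" if "i < n" for i
    using meet[of i n] that n last by auto
  then have "path_image p \<inter> path_image ?l \<subseteq> {vs ! n, vs ! 0}"
    using p(4) last by auto
  moreover have "arc ?l"
    using nth_ne[of n 0] n by (simp add: arc_linepath)
  ultimately have "simple_path (p +++ ?l)"
    using p by (intro simple_path_join_loop) auto
  moreover have "path_image (p +++ ?l) = C"
    using p last vs(3) n by (subst path_image_join) (auto simp: lessThan_Suc)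
  ultimately show thesis
    using that[of "p +++ ?l"] p by simp
qed

lemma pl_circle_connected_compact:
  fixes C :: "'a::euclidean_space set"
  assumes "pl_circle C"
  shows "connected C" "compact C" "C \<noteq> {}"
  using assms pl_circle_imp_simple_loop
  by (metis connected_simple_path_image compact_simple_path_image path_image_nonempty)+

lemma components_Union_finite_closed:
  assumes "finite \<C>" "pairwise disjnt \<C>" "\<And>C. C \<in> \<C> \<Longrightarrow> closed C \<and> connected C \<and> C \<noteq> {}"
  shows "components (\<Union>\<C>) = \<C>"
proof -
  have "C \<in> components (\<Union>\<C>)" if "C \<in> \<C>" for C
    unfolding in_components_maximal
  proof (intro conjI allI impI)
    fix X assume X: "X \<noteq> {} \<and> C \<subseteq> X \<and> X \<subseteq> \<Union>\<C> \<and> connected X"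
    have cl: "closed C" "closed (\<Union>(\<C> - {C}))"
      using assms that by (auto intro!: closed_Union)
    have "C \<inter> \<Union>(\<C> - {C}) = {}"
      using assms(2) that by (auto simp: pairwise_def disjnt_def) 
    then have "X \<inter> \<Union>(\<C> - {C}) = {}"
      using connected_closedD[of X C "\<Union>(\<C> - {C})"] X cl assms(3)[OF that] by blast
    then show "X = C" using X by blast
  qed (use assms that in auto)
  moreover have "C \<in> \<C>" if "C \<in> components (\<Union>\<C>)" for C
  proof -
    obtain x where "x \<in> C"
      using in_components_nonempty[OF \<open>C \<in> components (\<Union>\<C>)\<close>] by blast
    then have "x \<in> \<Union>\<C>"
      using in_components_subset[OF \<open>C \<in> components (\<Union>\<C>)\<close>] by blast
    then obtain C' where "C' \<in> \<C>" "x \<in> C'" by blast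
    then have "C' = C"
      using calculation[of C'] that \<open>x \<in> C\<close> components_eq by blast
    then show ?thesis using \<open>C' \<in> \<C>\<close> by simp
  qed
  ultimately show ?thesis by blast
qed

lemma union_of_disjoint_circles_components:
  fixes M :: "'a::euclidean_space set"
  assumes "union_of_disjoint_circles n M"
  shows "finite (components M)" "card (components M) = n" "\<And>C. C \<in> components M \<Longrightarrow> pl_circle C"
    "compact M"
proof -
  obtain \<C> where C: "finite \<C>" "card \<C> = n" "\<forall>C\<in>\<C>. pl_circle C" "pairwise disjnt \<C>" "M = \<Union>\<C>"
    using assms by (auto simp: union_of_disjoint_circles_def)
  then have "components M = \<C>"
    using components_Union_finite_closed[of \<C>] pl_circle_connected_compact
    by (metis compact_imp_closed)
  with C show "finite (components M)" "card (components M) = n" "\<And>C. C \<in> components M \<Longrightarrow> pl_circle C"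
    "compact M"
    using pl_circle_connected_compact by (auto intro!: compact_Union)
qed

lemma S2_homeomorphic_sphere: "S2 homeomorphic sphere (0::real^3) 1"
proof -
  have "rel_frontier std_cube homeomorphic rel_frontier (cball (0::real^3) 1)"
  proof (rule homeomorphic_rel_frontiers_convex_bounded_sets)
    have "interior std_cube \<noteq> {}"
      unfolding std_cube_def interior_cbox box_ne_empty by (auto simp: Basis_vec_def inner_axis)
    then show "aff_dim std_cube = aff_dim (cball (0::real^3) 1)"
      by (simp add: aff_dim_nonempty_interior)
  qed (auto simp: std_cube_def)
  moreover have "rel_frontier std_cube = S2"
  proof -
    have "interior std_cube \<noteq> {}"
      unfolding std_cube_def interior_cbox box_ne_empty by (auto simp: Basis_vec_def inner_axis)
    then show ?thesis unfolding S2_def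
      by (simp add: rel_frontier_def frontier_def rel_interior_nonempty_interior)
  qed
  ultimately show ?thesis by simp
qed

lemma pl_sphere_homeomorphic_sphere: "pl_sphere S \<Longrightarrow> S homeomorphic sphere (0::real^3) 1"
  using S2_homeomorphic_sphere homeomorphic_trans
  unfolding pl_sphere_def pl_homeomorphic_def pl_homeomorphism_def homeomorphic_def[of S S2, symmetric]
  by (metis homeomorphic_def)

section \<open>The local picture at a point of a transversal intersection\<close>

lemma in_closure_ball_Int_ray:
  fixes y v :: "'a::real_normed_vector"
  assumes "norm y < e" "norm v = 1" "\<And>t. t > 0 \<Longrightarrow> y + t *\<^sub>R v \<in> V"
  shows "y \<in> closure (ball 0 e \<inter> V)"
  unfolding closure_approachable
proof (intro allI impI)
  fix d :: real assume "d > 0"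
  define t where "t = min (d/2) ((e - norm y)/2)"
  have t: "t > 0" "t < d" "norm y + t < e"
  proof -
    have "t > 0"
      using \<open>d > 0\<close> assms(1) by (simp add: t_def)
    moreover have "t \<le> d/2" "t \<le> (e - norm y)/2"
      unfolding t_def by (rule min.cobounded1 min.cobounded2)+
    ultimately show "t > 0" "t < d" "norm y + t < e"
      using \<open>d > 0\<close> assms(1) by (simp_all add: field_simps)
  qed
  have "norm (y + t *\<^sub>R v) \<le> norm y + t"
    using norm_triangle_ineq[of y "t *\<^sub>R v"] assms(2) t(1) by simp
  then have "y + t *\<^sub>R v \<in> ball 0 e \<inter> V"
    using assms(3)[OF t(1)] t(3) by auto
  moreover have "dist (y + t *\<^sub>R v) y < d"
    using t assms(2) by (simp add: dist_norm)
  ultimately show "\<exists>z\<in>ball 0 e \<inter> V. dist z y < d" by blast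
qed

text \<open>The image of a small round ball under the chart. \<open>H1\<close> and \<open>H2\<close> are the two sides of \<open>T\<close>; \<open>G1\<close>
and \<open>G2\<close> are the two halves of \<open>S\<close>, each on its own side of \<open>T\<close>; \<open>K1\<close> and \<open>K2\<close> are the two
halves of \<open>T\<close>. The statements about closures express that every point of the intersection in \<open>N\<close>, not
just the center \<open>p\<close>, is approached from all of these halves.\<close>

lemma transversal_local_sides:
  assumes "transversal S T" "p \<in> S" "p \<in> T"
  obtains N H1 H2 G1 G2 K1 K2 where
    "open N" "p \<in> N"
    "connected H1" "connected H2" "N - T = H1 \<union> H2"
    "connected G1" "connected G2" "N \<inter> S - T = G1 \<union> G2" "G1 \<subseteq> H1" "G2 \<subseteq> H2"
    "N \<inter> (S \<inter> T) \<subseteq> closure G1 \<inter> closure G2"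
    "connected K1" "connected K2" "N \<inter> T - S = K1 \<union> K2"
    "N \<inter> (S \<inter> T) \<subseteq> closure K1 \<inter> closure K2"
proof -
  obtain U h k where U: "p \<in> interior U" "pl_homeomorphism U std_cube h k" "h p = 0"
    and hS: "h ` (S \<inter> U) = {x \<in> std_cube. x $ 1 = 0}"
    and hT: "h ` (T \<inter> U) = {x \<in> std_cube. x $ 2 = 0}"
    using assms unfolding transversal_def by blast
  have hk: "\<And>x. x \<in> U \<Longrightarrow> k (h x) = x" "\<And>y. y \<in> std_cube \<Longrightarrow> h (k y) = y"
    "h ` U = std_cube" "k ` std_cube = U" "continuous_on U h" "continuous_on std_cube k"
    using U(2) by (auto simp: pl_homeomorphism_def homeomorphism_def)
  have pU: "p \<in> U" using U(1) interior_subset by blast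
  have k0: "k 0 = p" using hk(1)[OF pU] U(3) by simp
  have cube: "cball 0 1 \<subseteq> std_cube"
  proof
    fix x :: "real^3" assume "x \<in> cball 0 1"
    then have "\<bar>x $ i\<bar> \<le> 1" for i
      using component_le_norm_cart[of x i] by simp
    then show "x \<in> std_cube"
      unfolding std_cube_def by (auto simp: mem_box_cart abs_le_iff minus_le_iff)
  qed
  have inS: "k y \<in> S \<longleftrightarrow> y $ 1 = 0" and inT: "k y \<in> T \<longleftrightarrow> y $ 2 = 0"
    if "y \<in> std_cube" for y
  proof -
    have "k y \<in> U" "h (k y) = y" using hk that by auto
    have *: "k y \<in> X \<longleftrightarrow> P y" if "h ` (X \<inter> U) = {x \<in> std_cube. P x}" for X P
    proof
      assume "k y \<in> X"
      then have "h (k y) \<in> h ` (X \<inter> U)" using \<open>k y \<in> U\<close> by blast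
      then show "P y" using that \<open>h (k y) = y\<close> by simp
    next
      assume "P y"
      then have "y \<in> h ` (X \<inter> U)" using that \<open>y \<in> std_cube\<close> by simp
      then show "k y \<in> X" using hk(1) by auto
    qed
    show "k y \<in> S \<longleftrightarrow> y $ 1 = 0" by (rule *[OF hS])
    show "k y \<in> T \<longleftrightarrow> y $ 2 = 0" by (rule *[OF hT])
  qed
  obtain d where d: "d > 0" "\<And>y. y \<in> std_cube \<Longrightarrow> norm y < d \<Longrightarrow> k y \<in> interior U"
  proof -
    have "\<exists>d>0. \<forall>y\<in>std_cube. dist y 0 < d \<longrightarrow> k y \<in> interior U"
    proof -
      obtain r where r: "r > 0" "ball p r \<subseteq> interior U"
        using U(1) openE[OF open_interior] by blast
      have "0 \<in> std_cube" using cube by auto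
      then obtain d where "d > 0" "\<And>y. y \<in> std_cube \<Longrightarrow> dist y 0 < d \<Longrightarrow> dist (k y) (k 0) < r"
        using hk(6) r(1) unfolding continuous_on_iff by metis
      then show ?thesis using r(2) k0 by (metis dist_commute mem_ball subsetD)
    qed
    then show thesis using that by auto
  qed
  define e where "e = min d 1"
  have e: "e > 0" "e \<le> d" "cball 0 e \<subseteq> std_cube"
  proof -
    show "e > 0" "e \<le> d" using d(1) by (auto simp: e_def)
    have "cball 0 e \<subseteq> cball (0::real^3) 1" by (auto simp: e_def)
    then show "cball 0 e \<subseteq> std_cube" using cube by blast
  qed
  let ?B = "ball (0::real^3) e"
  have Bc: "?B \<subseteq> std_cube" using e(3) ball_subset_cball by blast
  have contB: "continuous_on X k" if "X \<subseteq> std_cube" for X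
    using hk(6) that continuous_on_subset by blast
  have con: "connected (k ` (?B \<inter> V))" if "convex V" for V
    by (intro connected_continuous_image contB convex_connected convex_Int that) (use Bc in auto)
  have half: "convex {x::real^3. x $ i > 0}" "convex {x::real^3. x $ i < 0}" "convex {x::real^3. x $ i = 0}" for i
    using convex_halfspace_gt[of 0 "axis i (1::real)"] convex_halfspace_lt[of "axis i (1::real)" 0]
      convex_hyperplane[of "axis i (1::real)" 0]
    by (simp_all add: cart_eq_inner_axis inner_commute)
  have clo: "k y \<in> closure (k ` (?B \<inter> V))"
    if "norm y < e" "norm v = 1" "\<And>t. t > 0 \<Longrightarrow> y + t *\<^sub>R v \<in> V" for y v V
  proof -
    have "closure (?B \<inter> V) \<subseteq> cball 0 e"
      by (rule closure_minimal) auto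
    then have "k ` closure (?B \<inter> V) \<subseteq> closure (k ` (?B \<inter> V))"
      using e(3) by (intro image_closure_subset contB closure_subset closed_closure) blast
    then show ?thesis
      using in_closure_ball_Int_ray[OF that] by blast
  qed
  define N where "N = k ` ?B"
  \<comment> \<open>The chart image is only known to be open relative to \<open>U\<close>; being inside the interior of \<open>U\<close>, it is open.\<close>
  have "openin (top_of_set U) (U \<inter> h -` ?B)"
    by (rule continuous_openin_preimage_gen[OF hk(5)]) simp
  moreover have N_eq: "N = U \<inter> h -` ?B"
  proof
    show "N \<subseteq> U \<inter> h -` ?B" using hk(2,4) Bc by (auto simp: N_def)
    show "U \<inter> h -` ?B \<subseteq> N"
    proof
      fix x assume "x \<in> U \<inter> h -` ?B"
      then have "x = k (h x)" "h x \<in> ?B" using hk(1) by auto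
      then show "x \<in> N" unfolding N_def by blast
    qed
  qed
  moreover have "N \<subseteq> interior U"
    using d(2) e(2) Bc by (auto simp: N_def)
  ultimately have "openin (top_of_set (interior U)) N"
    by (metis interior_subset openin_subset_trans)
  then have "open N" by (rule openin_open_trans) simp
  let ?H = "\<lambda>V. k ` (?B \<inter> V)"
  show thesis
  proof
    show "open N" by fact
    show "p \<in> N" using k0 e(1) by (auto simp: N_def)
    show "connected (?H {x. x $ 2 > 0})" "connected (?H {x. x $ 2 < 0})"
         "connected (?H ({x. x $ 1 = 0} \<inter> {x. x $ 2 > 0}))" "connected (?H ({x. x $ 1 = 0} \<inter> {x. x $ 2 < 0}))"
         "connected (?H ({x. x $ 2 = 0} \<inter> {x. x $ 1 > 0}))" "connected (?H ({x. x $ 2 = 0} \<inter> {x. x $ 1 < 0}))"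
      by (intro con convex_Int half)+
    have B: "y \<in> std_cube" if "y \<in> ?B" for y using Bc that by blast
    show "N - T = ?H {x. x $ 2 > 0} \<union> ?H {x. x $ 2 < 0}"
      unfolding N_def using inT[OF B] by (force simp: image_iff neq_iff)
    show "N \<inter> S - T = ?H ({x. x $ 1 = 0} \<inter> {x. x $ 2 > 0}) \<union> ?H ({x. x $ 1 = 0} \<inter> {x. x $ 2 < 0})"
      unfolding N_def using inT[OF B] inS[OF B] by (force simp: image_iff neq_iff)
    show "N \<inter> T - S = ?H ({x. x $ 2 = 0} \<inter> {x. x $ 1 > 0}) \<union> ?H ({x. x $ 2 = 0} \<inter> {x. x $ 1 < 0})"
      unfolding N_def using inT[OF B] inS[OF B] by (force simp: image_iff neq_iff)
    show "?H ({x. x $ 1 = 0} \<inter> {x. x $ 2 > 0}) \<subseteq> ?H {x. x $ 2 > 0}"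
         "?H ({x. x $ 1 = 0} \<inter> {x. x $ 2 < 0}) \<subseteq> ?H {x. x $ 2 < 0}"
      by auto
    have ax: "norm (axis i 1 :: real^3) = 1" "norm (- axis i 1 :: real^3) = 1" for i
      by (simp_all add: norm_axis_1)
    have ne: "(1::3) \<noteq> 2" "(2::3) \<noteq> 1" by simp_all
    have axn: "(axis 1 1 :: real^3) $ 1 = 1" "(axis 2 1 :: real^3) $ 2 = 1"
      "(axis 1 1 :: real^3) $ 2 = 0" "(axis 2 1 :: real^3) $ 1 = 0"
      using ne by (simp_all add: axis_def)
    have pt: "\<exists>y. x = k y \<and> norm y < e \<and> y $ 1 = 0 \<and> y $ 2 = 0" if "x \<in> N \<inter> (S \<inter> T)" for x
      using that inT[OF B] inS[OF B] by (auto simp: N_def)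
    show "N \<inter> (S \<inter> T) \<subseteq> closure (?H ({x. x $ 1 = 0} \<inter> {x. x $ 2 > 0})) \<inter> closure (?H ({x. x $ 1 = 0} \<inter> {x. x $ 2 < 0}))"
    proof
      fix x assume "x \<in> N \<inter> (S \<inter> T)"
      then obtain y where "x = k y" "norm y < e" "y $ 1 = 0" "y $ 2 = 0" using pt by blast
      note y = this
      have "k y \<in> closure (?H ({x. x $ 1 = 0} \<inter> {x. x $ 2 > 0}))"
        by (rule clo[OF y(2) ax(1)[of 2]]) (simp add: y axn)
      moreover have "k y \<in> closure (?H ({x. x $ 1 = 0} \<inter> {x. x $ 2 < 0}))"
        by (rule clo[OF y(2) ax(2)[of 2]]) (simp add: y axn)
      ultimately show "x \<in> closure (?H ({x. x $ 1 = 0} \<inter> {x. x $ 2 > 0})) \<inter> closure (?H ({x. x $ 1 = 0} \<inter> {x. x $ 2 < 0}))"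
        using y(1) by blast
    qed
    show "N \<inter> (S \<inter> T) \<subseteq> closure (?H ({x. x $ 2 = 0} \<inter> {x. x $ 1 > 0})) \<inter> closure (?H ({x. x $ 2 = 0} \<inter> {x. x $ 1 < 0}))"
    proof
      fix x assume "x \<in> N \<inter> (S \<inter> T)"
      then obtain y where "x = k y" "norm y < e" "y $ 1 = 0" "y $ 2 = 0" using pt by blast
      note y = this
      have "k y \<in> closure (?H ({x. x $ 2 = 0} \<inter> {x. x $ 1 > 0}))"
        by (rule clo[OF y(2) ax(1)[of 1]]) (simp add: y axn)
      moreover have "k y \<in> closure (?H ({x. x $ 2 = 0} \<inter> {x. x $ 1 < 0}))"
        by (rule clo[OF y(2) ax(2)[of 1]]) (simp add: y axn)
      ultimately show "x \<in> closure (?H ({x. x $ 2 = 0} \<inter> {x. x $ 1 > 0})) \<inter> closure (?H ({x. x $ 2 = 0} \<inter> {x. x $ 1 < 0}))"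
        using y(1) by blast
    qed
  qed
qed

section \<open>Circles as edges of the dual graph\<close>

text \<open>What a transversal intersection \<open>M\<close> contributes to the dual graph in \<open>S\<close>: locally
\<open>M\<close> has two connected sides in \<open>S\<close>, which both accumulate at all nearby points of \<open>M\<close>.\<close>

definition locally_two_sided :: "'a::topological_space set \<Rightarrow> 'a set \<Rightarrow> bool" where
  "locally_two_sided S M \<longleftrightarrow>
     (\<forall>p\<in>M. \<exists>N G1 G2. open N \<and> p \<in> N \<and> connected G1 \<and> connected G2 \<and>
        N \<inter> S - M = G1 \<union> G2 \<and> N \<inter> M \<subseteq> closure G1 \<inter> closure G2)"

lemma locally_two_sidedE:
  assumes "locally_two_sided S M" "p \<in> M"
  obtains N G1 G2 where "open N" "p \<in> N" "connected G1" "connected G2" "G1 \<noteq> {}" "G2 \<noteq> {}"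
    "N \<inter> S - M = G1 \<union> G2" "N \<inter> M \<subseteq> closure G1 \<inter> closure G2"
proof -
  obtain N G1 G2 where *: "open N" "p \<in> N" "connected G1" "connected G2"
    "N \<inter> S - M = G1 \<union> G2" "N \<inter> M \<subseteq> closure G1 \<inter> closure G2"
    using assms unfolding locally_two_sided_def by meson
  then have "p \<in> closure G1" "p \<in> closure G2" using assms(2) by blast+
  then have "G1 \<noteq> {}" "G2 \<noteq> {}" by auto
  with * that show thesis by blast
qed

definition sides :: "'a::topological_space set \<Rightarrow> 'a set \<Rightarrow> 'a set \<Rightarrow> 'a set set" where
  "sides S M C = {U \<in> components (S - M). C \<subseteq> closure U}"

text \<open>Whether a region accumulates at \<open>q\<close> does not depend on the choice of \<open>q\<close> in \<open>N \<inter> M\<close>, as the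
right-hand side shows. This makes the set of adjacent regions locally constant along a circle.\<close>

lemma closure_region_local:
  assumes "open N" "connected G1" "connected G2" "G1 \<noteq> {}" "G2 \<noteq> {}"
    "N \<inter> S - M = G1 \<union> G2" "N \<inter> M \<subseteq> closure G1 \<inter> closure G2"
    "U \<in> components (S - M)" "q \<in> N" "q \<in> M"
  shows "q \<in> closure U \<longleftrightarrow> G1 \<subseteq> U \<or> G2 \<subseteq> U"
proof
  assume "q \<in> closure U"
  then have "N \<inter> U \<noteq> {}"
    using assms(1,9) closure_iff_nhds_not_empty by (metis inf_commute order_refl)
  then have "U \<inter> G1 \<noteq> {} \<or> U \<inter> G2 \<noteq> {}"
    using assms(6) in_components_subset[OF assms(8)] by blast
  moreover have "G1 \<subseteq> S - M" "G2 \<subseteq> S - M" using assms(6) by auto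
  ultimately show "G1 \<subseteq> U \<or> G2 \<subseteq> U"
    using components_maximal[OF assms(8)] assms(2,3) by metis
next
  assume "G1 \<subseteq> U \<or> G2 \<subseteq> U"
  then have "closure G1 \<subseteq> closure U \<or> closure G2 \<subseteq> closure U"
    using closure_mono by blast
  then show "q \<in> closure U" using assms(7,9,10) by blast
qed

lemma circle_subset_closure_region:
  assumes "locally_two_sided S M" "C \<in> components M" "p \<in> C" "U \<in> components (S - M)" "p \<in> closure U"
  shows "C \<subseteq> closure U"
proof
  fix q assume "q \<in> C"
  have "(p \<in> closure U) = (q \<in> closure U)"
  proof (rule connected_local_const[of C p q "\<lambda>x. x \<in> closure U"])
    show "\<forall>a\<in>C. \<forall>\<^sub>F b in at a within C. (a \<in> closure U) = (b \<in> closure U)"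
    proof
      fix a assume "a \<in> C"
      have "C \<subseteq> M" using assms(2) in_components_subset by blast
      then have "a \<in> M" using \<open>a \<in> C\<close> by blast
      obtain N G1 G2 where N: "open N" "a \<in> N" "connected G1" "connected G2" "G1 \<noteq> {}" "G2 \<noteq> {}"
        "N \<inter> S - M = G1 \<union> G2" "N \<inter> M \<subseteq> closure G1 \<inter> closure G2"
        using locally_two_sidedE[OF assms(1) \<open>a \<in> M\<close>] by metis
      note * = closure_region_local[OF N(1,3-8) assms(4)]
      show "\<forall>\<^sub>F b in at a within C. (a \<in> closure U) = (b \<in> closure U)"
        unfolding eventually_at_topological
      proof (intro exI[of _ N] conjI ballI impI)
        fix b assume "b \<in> N" "b \<in> C"
        then show "(a \<in> closure U) = (b \<in> closure U)"
          using *[of a] *[of b] N(2) \<open>a \<in> M\<close> \<open>C \<subseteq> M\<close> by blast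
      qed (use N in auto)
    qed
  qed (use assms in_components_connected \<open>q \<in> C\<close> in auto)
  then show "q \<in> closure U" using assms by simp
qed

lemma sides_eq_pair:
  assumes "locally_two_sided S M" "C \<in> components M"
  obtains U V where "sides S M C = {U, V}"
proof -
  obtain p where "p \<in> C" using in_components_nonempty[OF assms(2)] by blast
  then have "p \<in> M" using in_components_subset[OF assms(2)] by blast
  obtain N G1 G2 where N: "open N" "p \<in> N" "connected G1" "connected G2" "G1 \<noteq> {}" "G2 \<noteq> {}"
        "N \<inter> S - M = G1 \<union> G2" "N \<inter> M \<subseteq> closure G1 \<inter> closure G2"
    using locally_two_sidedE[OF assms(1) \<open>p \<in> M\<close>] by metis
  have sub: "G1 \<subseteq> S - M" "G2 \<subseteq> S - M" using N(7) by auto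
  then have ne: "S - M \<noteq> {}" using N(5) by auto
  obtain U where U: "U \<in> components (S - M)" "G1 \<subseteq> U"
    using exists_component_superset[OF sub(1) ne N(3)] by blast
  obtain V where V: "V \<in> components (S - M)" "G2 \<subseteq> V"
    using exists_component_superset[OF sub(2) ne N(4)] by blast
  have "W \<in> sides S M C \<longleftrightarrow> W = U \<or> W = V" for W
  proof
    assume W: "W \<in> sides S M C"
    then have "W \<in> components (S - M)" "p \<in> closure W"
      using \<open>p \<in> C\<close> by (auto simp: sides_def)
    then have "G1 \<subseteq> W \<or> G2 \<subseteq> W"
      using closure_region_local[OF N(1,3-8) _ N(2) \<open>p \<in> M\<close>] by blast
    then have "W \<inter> U \<noteq> {} \<or> W \<inter> V \<noteq> {}"
      using U(2) V(2) N(5,6) by blast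
    then show "W = U \<or> W = V"
      using components_eq[OF \<open>W \<in> components (S - M)\<close>] U(1) V(1) by blast
  next
    have "X \<in> sides S M C" if "X \<in> components (S - M)" "G1 \<subseteq> X \<or> G2 \<subseteq> X" for X
      using circle_subset_closure_region[OF assms \<open>p \<in> C\<close> that(1)] that(1)
        closure_region_local[OF N(1,3-8) that(1) N(2) \<open>p \<in> M\<close>] that(2)
      by (simp add: sides_def)
    then show "W \<in> sides S M C" if "W = U \<or> W = V"
      using that U V by blast
  qed
  then have "sides S M C = {U, V}" by blast
  then show thesis by (rule that)
qed

lemma closure_region_Int:
  assumes "U \<in> components (S - M)"
  shows "closure U \<inter> (S - M) = U"
proof -
  obtain K where K: "closed K" "U = (S - M) \<inter> K"
    using closedin_component[OF assms] unfolding closedin_closed by blast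
  then have "closure U \<subseteq> K"
    by (intro closure_minimal) auto
  then show ?thesis using closure_subset[of U] K(2) by blast
qed

lemma mem_circle:
  assumes "x \<in> M" obtains C where "C \<in> components M" "x \<in> C"
  using assms Union_components by (metis UnionE)

lemma region_sides_of_circle:
  assumes "locally_two_sided S M" "C \<in> components M" "p \<in> C" "U \<in> components (S - M)"
  shows "p \<in> closure U \<longleftrightarrow> U \<in> sides S M C"
  using circle_subset_closure_region[OF assms(1-4)] assms(3,4) by (auto simp: sides_def)

text \<open>A circle need not have two different regions at its sides as far as local considerations go; the
circles that do are the ones that yield edges.\<close>

lemma snd_dual_graph:
  assumes "locally_two_sided S M"
  shows "snd (dual_graph S M) = sides S M ` {C \<in> components M. card (sides S M C) = 2}"
proof
  show "snd (dual_graph S M) \<subseteq> sides S M ` {C \<in> components M. card (sides S M C) = 2}"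
  proof
    fix E assume "E \<in> snd (dual_graph S M)"
    then obtain U V C where *: "E = {U, V}" "U \<noteq> V" "C \<in> components M" "U \<in> sides S M C" "V \<in> sides S M C"
      by (auto simp: dual_graph_def neighbors_def sides_def)
    obtain U' V' where "sides S M C = {U', V'}" using sides_eq_pair[OF assms *(3)] .
    then have "sides S M C = E" using * by auto
    moreover have "card E = 2" using * by simp
    ultimately show "E \<in> sides S M ` {C \<in> components M. card (sides S M C) = 2}"
      using *(3) by blast
  qed
  show "sides S M ` {C \<in> components M. card (sides S M C) = 2} \<subseteq> snd (dual_graph S M)"
  proof
    fix E assume "E \<in> sides S M ` {C \<in> components M. card (sides S M C) = 2}"
    then obtain C where C: "C \<in> components M" "card (sides S M C) = 2" "E = sides S M C" by blast
    then obtain U V where UV: "E = {U, V}" "U \<noteq> V" by (auto simp: card_2_iff)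
    then have "U \<in> sides S M C" "V \<in> sides S M C" using C(3) by auto
    then have "U \<in> components (S - M)" "V \<in> components (S - M)" "neighbors M U V"
      using C UV by (auto simp: sides_def neighbors_def)
    then show "E \<in> snd (dual_graph S M)"
      using UV by (auto simp: dual_graph_def)
  qed
qed

text \<open>Counting replaces a global separation argument here: every edge comes from a circle, so if there
are as many edges as circles, then each circle has two different sides and no two circles
yield the same edge.\<close>

lemma sides_bij_edges:
  assumes "locally_two_sided S M" "finite (components M)"
    and "card (snd (dual_graph S M)) = card (components M)"
  shows "bij_betw (sides S M) (components M) (snd (dual_graph S M))"
proof -
  let ?X = "{C \<in> components M. card (sides S M C) = 2}"
  have fin: "finite ?X" "?X \<subseteq> components M" using assms(2) by auto
  have "card (snd (dual_graph S M)) \<le> card ?X"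
    unfolding snd_dual_graph[OF assms(1)] by (rule card_image_le[OF fin(1)])
  then have X: "?X = components M"
    using assms fin by (intro card_seteq) auto
  then have im: "sides S M ` components M = snd (dual_graph S M)"
    using snd_dual_graph[OF assms(1)] by simp
  then show ?thesis
    using assms by (auto simp: bij_betw_def intro: eq_card_imp_inj_on)
qed

section \<open>Transport of dual graphs and of edge labels\<close>

lemma homeomorphism_component_image:
  assumes h: "homeomorphism A B f g" and U: "U \<in> components A"
  shows "f ` U \<in> components B"
proof -
  have U': "U \<subseteq> A" "U \<noteq> {}" "connected U"
    using U in_components_subset in_components_nonempty in_components_connected by auto
  have h': "continuous_on A f" "continuous_on B g" "f ` A = B" "g ` B = A"
    "\<And>x. x \<in> A \<Longrightarrow> g (f x) = x" "\<And>y. y \<in> B \<Longrightarrow> f (g y) = y"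
    using h by (auto simp: homeomorphism_def)
  have "connected (f ` U)"
    by (rule connected_continuous_image[OF continuous_on_subset[OF h'(1) U'(1)] U'(3)])
  moreover have "f ` U \<subseteq> B" using U'(1) h'(3) by blast
  moreover have "X = f ` U" if X: "f ` U \<subseteq> X" "X \<subseteq> B" "connected X" for X
  proof -
    have 1: "connected (g ` X)"
      by (rule connected_continuous_image[OF continuous_on_subset[OF h'(2) X(2)] X(3)])
    have 2: "g ` X \<subseteq> A" using X(2) h'(4) by blast
    have "g ` f ` U = U"
      using U'(1) h'(5) by (force simp: image_image)
    then have 3: "U \<subseteq> g ` X" using X(1) by (metis image_mono)
    then have "U \<inter> g ` X \<noteq> {}" using U'(2) by (simp add: Int_absorb2)
    then have "g ` X = U"
      using components_maximal[OF U 1 2] 3 by (intro equalityI)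
    then have "f ` g ` X = f ` U" by simp
    moreover have "f ` g ` X = X"
      using X(2) h'(6) by (force simp: image_image)
    ultimately show ?thesis by simp
  qed
  ultimately show ?thesis
    using U'(2) unfolding in_components_maximal by (metis image_is_empty)
qed

lemma homeomorphism_closure_image:
  fixes S :: "'a::metric_space set" and T :: "'b::metric_space set"
  assumes "homeomorphism S T f g" "compact S" "U \<subseteq> S"
  shows "f ` closure U = closure (f ` U)"
proof
  have cU: "closure U \<subseteq> S"
    using assms by (simp add: closure_minimal compact_imp_closed)
  have "continuous_on (closure U) f"
    using assms(1) cU by (auto simp: homeomorphism_def intro: continuous_on_subset)
  then show "f ` closure U \<subseteq> closure (f ` U)"
    by (intro image_closure_subset closure_subset closed_closure)
  have "compact (closure U)"
    using assms(2) cU compact_closure bounded_subset compact_imp_bounded closure_subset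
    by (metis closed_closure compact_Int_closed inf.absorb_iff2)
  then have "compact (f ` closure U)"
    using \<open>continuous_on (closure U) f\<close> compact_continuous_image by blast
  then show "closure (f ` U) \<subseteq> f ` closure U"
    by (intro closure_minimal compact_imp_closed image_mono closure_subset)
qed

lemma mem_snd_dual_graph:
  assumes "U \<in> components (S - M)" "V \<in> components (S - M)"
  shows "{U, V} \<in> snd (dual_graph S M) \<longleftrightarrow> neighbors M U V"
proof -
  have "neighbors M U V" if "neighbors M V U"
    using that unfolding neighbors_def by blast
  then show ?thesis
    using assms unfolding dual_graph_def by (auto simp: doubleton_eq_iff) 
qed

lemma homeomorphism_graph_isomorphic_dual_graph:
  assumes h: "homeomorphism S T f g" and "compact S" "compact T" "M \<subseteq> S"
  shows "graph_isomorphic (dual_graph S M) (dual_graph T (f ` M))"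
proof -
  have h': "homeomorphism T S g f" using h by (rule homeomorphism_symD)
  have gf: "g ` f ` X = X" if "X \<subseteq> S" for X
    using that h by (force simp: homeomorphism_def image_image)
  have fg: "f ` g ` X = X" if "X \<subseteq> T" for X
    using that h' by (force simp: homeomorphism_def image_image)
  have inj: "inj_on f S"
    using h by (auto simp: homeomorphism_def intro: inj_on_inverseI)
  have fS: "f ` S = T" using h by (simp add: homeomorphism_def)
  have img: "f ` (S - M) = T - f ` M"
    using inj_on_image_set_diff[OF inj _ assms(4), of S] fS by simp
  have h1: "homeomorphism (S - M) (T - f ` M) f g"
    using homeomorphism_of_subsets[OF h _ _ img] by auto
  have h2: "homeomorphism M (f ` M) f g"
    using homeomorphism_of_subsets[OF h assms(4) _ refl] fS assms(4) by auto
  note h1' = homeomorphism_symD[OF h1] and h2' = homeomorphism_symD[OF h2]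
  have subS: "U \<subseteq> S" if "U \<in> components (S - M)" for U
    using in_components_subset[OF that] by blast
  have subT: "U \<subseteq> T" if "U \<in> components (T - f ` M)" for U
    using in_components_subset[OF that] by blast
  have bij: "bij_betw ((`) f) (components (S - M)) (components (T - f ` M))"
    by (rule bij_betw_byWitness[where f' = "(`) g"])
       (use gf[OF subS] fg[OF subT] homeomorphism_component_image[OF h1]
          homeomorphism_component_image[OF h1'] in auto)
  have cl: "C \<subseteq> closure U \<longleftrightarrow> f ` C \<subseteq> closure (f ` U)"
    if "C \<in> components M" "U \<in> components (S - M)" for C U
  proof -
    have "C \<subseteq> S" using in_components_subset[OF that(1)] assms(4) by blast
    moreover have "closure U \<subseteq> S"
      using subS[OF that(2)] assms(2) by (simp add: closure_minimal compact_imp_closed)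
    ultimately have "f ` C \<subseteq> f ` closure U \<longleftrightarrow> C \<subseteq> closure U"
      by (rule inj_on_image_subset_iff[OF inj])
    then show ?thesis
      using homeomorphism_closure_image[OF h assms(2) subS[OF that(2)]] by simp
  qed
  have nb: "neighbors M U V \<longleftrightarrow> neighbors (f ` M) (f ` U) (f ` V)"
    if U: "U \<in> components (S - M)" and V: "V \<in> components (S - M)" for U V
  proof -
    have "U = V \<longleftrightarrow> f ` U = f ` V"
      using gf[OF subS[OF U]] gf[OF subS[OF V]] by metis
    moreover have "components (f ` M) = (`) f ` components M"
    proof
      show "(`) f ` components M \<subseteq> components (f ` M)"
        using homeomorphism_component_image[OF h2] by blast
      show "components (f ` M) \<subseteq> (`) f ` components M"
      proof
        fix C assume C: "C \<in> components (f ` M)"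
        then have "f ` g ` C = C"
          using in_components_subset[OF C] assms(4) fS by (intro fg) blast
        then show "C \<in> (`) f ` components M"
          using homeomorphism_component_image[OF h2' C] by (metis imageI)
      qed
    qed
    ultimately show ?thesis
      using cl U V unfolding neighbors_def by (simp add: bex_simps cong: bex_cong)
  qed
  show ?thesis
    unfolding graph_isomorphic_def
  proof (intro exI[of _ "(`) f"] conjI ballI)
    show "bij_betw ((`) f) (fst (dual_graph S M)) (fst (dual_graph T (f ` M)))"
      using bij by (simp add: dual_graph_def)
    fix U V assume "U \<in> fst (dual_graph S M)" "V \<in> fst (dual_graph S M)"
    then have UV: "U \<in> components (S - M)" "V \<in> components (S - M)"
      by (simp_all add: dual_graph_def)
    then show "{U, V} \<in> snd (dual_graph S M) \<longleftrightarrow> {f ` U, f ` V} \<in> snd (dual_graph T (f ` M))"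
      using mem_snd_dual_graph[OF UV] nb[OF UV] mem_snd_dual_graph[of "f ` U" T "f ` M" "f ` V"]
        homeomorphism_component_image[OF h1] by simp
  qed
qed

lemma graph_isomorphic_trans:
  assumes "graph_isomorphic G H" "graph_isomorphic H K"
  shows "graph_isomorphic G K"
proof -
  obtain \<phi> where \<phi>: "bij_betw \<phi> (fst G) (fst H)"
    "\<And>u v. u \<in> fst G \<Longrightarrow> v \<in> fst G \<Longrightarrow> {u, v} \<in> snd G \<longleftrightarrow> {\<phi> u, \<phi> v} \<in> snd H"
    using assms(1) unfolding graph_isomorphic_def by blast
  obtain \<psi> where \<psi>: "bij_betw \<psi> (fst H) (fst K)"
    "\<And>u v. u \<in> fst H \<Longrightarrow> v \<in> fst H \<Longrightarrow> {u, v} \<in> snd H \<longleftrightarrow> {\<psi> u, \<psi> v} \<in> snd K"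
    using assms(2) unfolding graph_isomorphic_def by blast
  have "\<phi> u \<in> fst H" if "u \<in> fst G" for u
    using \<phi>(1) that by (auto simp: bij_betw_def)
  then show ?thesis
    unfolding graph_isomorphic_def using \<phi> \<psi> bij_betw_trans[OF \<phi>(1) \<psi>(1)]
    by (intro exI[of _ "\<psi> \<circ> \<phi>"]) simp
qed

text \<open>A graph is an arbitrary pair of sets, and isomorphisms control only the edges between its vertices.\<close>

definition edges_between_vertices :: "'a graph \<Rightarrow> bool" where
  "edges_between_vertices G \<longleftrightarrow> (\<forall>E\<in>snd G. \<exists>u\<in>fst G. \<exists>v\<in>fst G. E = {u, v})"

lemma graph_isomorphism_bij_edges:
  assumes \<phi>: "bij_betw \<phi> (fst G) (fst H)"
    "\<And>u v. u \<in> fst G \<Longrightarrow> v \<in> fst G \<Longrightarrow> {u, v} \<in> snd G \<longleftrightarrow> {\<phi> u, \<phi> v} \<in> snd H"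
    and G: "edges_between_vertices G" and H: "edges_between_vertices H"
  shows "bij_betw ((`) \<phi>) (snd G) (snd H)"
  unfolding bij_betw_def
proof
  have "inj_on ((`) \<phi>) (Pow (fst G))"
    using \<phi>(1) by (simp add: bij_betw_def inj_on_image_Pow)
  moreover have "snd G \<subseteq> Pow (fst G)"
    using G by (auto simp: edges_between_vertices_def)
  ultimately show "inj_on ((`) \<phi>) (snd G)"
    using inj_on_subset by blast
  show "(`) \<phi> ` snd G = snd H"
  proof (intro set_eqI iffI)
    fix E assume "E \<in> (`) \<phi> ` snd G"
    then obtain E' where E': "E' \<in> snd G" "E = \<phi> ` E'" by blast
    then obtain u v where "u \<in> fst G" "v \<in> fst G" "E' = {u, v}"
      using G unfolding edges_between_vertices_def by blast
    then show "E \<in> snd H" using E' \<phi>(2)[of u v] by simp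
  next
    fix E assume E: "E \<in> snd H"
    then obtain x y where xy: "x \<in> fst H" "y \<in> fst H" "E = {x, y}"
      using H unfolding edges_between_vertices_def by blast
    then obtain u v where "u \<in> fst G" "v \<in> fst G" "x = \<phi> u" "y = \<phi> v"
      using \<phi>(1) unfolding bij_betw_def by blast
    then have "{u, v} \<in> snd G" "E = \<phi> ` {u, v}" using \<phi>(2)[of u v] E xy by auto
    then show "E \<in> (`) \<phi> ` snd G" by blast
  qed
qed

text \<open>Equality of the numbers of circles and of edges of \<open>H\<close> is what makes the labelling of circles by edges a
bijection, through \<open>sides_bij_edges\<close>.\<close>

lemma circle_labelling:
  assumes two: "locally_two_sided S M" and fin: "finite (components M)"
    and iso: "graph_isomorphic (dual_graph S M) H" and H: "edges_between_vertices H"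
    and card: "card (snd H) = card (components M)"
  obtains \<phi> where "bij_betw \<phi> (components (S - M)) (fst H)"
    "bij_betw (\<lambda>C. \<phi> ` sides S M C) (components M) (snd H)"
proof -
  obtain \<phi> where \<phi>: "bij_betw \<phi> (fst (dual_graph S M)) (fst H)"
    "\<And>u v. u \<in> fst (dual_graph S M) \<Longrightarrow> v \<in> fst (dual_graph S M) \<Longrightarrow>
        {u, v} \<in> snd (dual_graph S M) \<longleftrightarrow> {\<phi> u, \<phi> v} \<in> snd H"
    using iso unfolding graph_isomorphic_def by blast
  have "edges_between_vertices (dual_graph S M)"
    by (auto simp: edges_between_vertices_def dual_graph_def)
  then have bij: "bij_betw ((`) \<phi>) (snd (dual_graph S M)) (snd H)"
    using graph_isomorphism_bij_edges[OF \<phi>] H by blast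
  then have "bij_betw (sides S M) (components M) (snd (dual_graph S M))"
    using card by (intro sides_bij_edges two fin) (simp add: bij_betw_same_card)
  then have "bij_betw ((`) \<phi> \<circ> sides S M) (components M) (snd H)"
    using bij by (rule bij_betw_trans)
  then show thesis
    using that[of \<phi>] \<phi>(1) by (simp add: comp_def dual_graph_def)
qed

section \<open>A leaf disc does not separate the boundary of another region\<close>

lemma transversal_locally_two_sided:
  assumes "transversal S T"
  shows "locally_two_sided S (S \<inter> T)" "locally_two_sided T (S \<inter> T)"
proof -
  have left: "\<exists>N G1 G2. open N \<and> p \<in> N \<and> connected G1 \<and> connected G2 \<and>
        N \<inter> S - S \<inter> T = G1 \<union> G2 \<and> N \<inter> (S \<inter> T) \<subseteq> closure G1 \<inter> closure G2"
    and right: "\<exists>N G1 G2. open N \<and> p \<in> N \<and> connected G1 \<and> connected G2 \<and>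
        N \<inter> T - S \<inter> T = G1 \<union> G2 \<and> N \<inter> (S \<inter> T) \<subseteq> closure G1 \<inter> closure G2"
    if p: "p \<in> S \<inter> T" for p
  proof -
    obtain N H1 H2 G1 G2 K1 K2 where N: "open N" "p \<in> N"
      "connected H1" "connected H2" "N - T = H1 \<union> H2"
      "connected G1" "connected G2" "N \<inter> S - T = G1 \<union> G2" "G1 \<subseteq> H1" "G2 \<subseteq> H2"
      "N \<inter> (S \<inter> T) \<subseteq> closure G1 \<inter> closure G2"
      "connected K1" "connected K2" "N \<inter> T - S = K1 \<union> K2"
      "N \<inter> (S \<inter> T) \<subseteq> closure K1 \<inter> closure K2"
      using transversal_local_sides[OF assms] p by (metis IntD1 IntD2)
    have eq: "N \<inter> S - S \<inter> T = N \<inter> S - T" "N \<inter> T - S \<inter> T = N \<inter> T - S" by auto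
    show "\<exists>N G1 G2. open N \<and> p \<in> N \<and> connected G1 \<and> connected G2 \<and>
        N \<inter> S - S \<inter> T = G1 \<union> G2 \<and> N \<inter> (S \<inter> T) \<subseteq> closure G1 \<inter> closure G2"
      by (intro exI[of _ N] exI[of _ G1] exI[of _ G2]) (simp only: eq N simp_thms)
    show "\<exists>N G1 G2. open N \<and> p \<in> N \<and> connected G1 \<and> connected G2 \<and>
        N \<inter> T - S \<inter> T = G1 \<union> G2 \<and> N \<inter> (S \<inter> T) \<subseteq> closure G1 \<inter> closure G2"
      by (intro exI[of _ N] exI[of _ K1] exI[of _ K2]) (simp only: eq N simp_thms)
  qed
  show "locally_two_sided S (S \<inter> T)" "locally_two_sided T (S \<inter> T)"
    unfolding locally_two_sided_def by (intro ballI left right; assumption)+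
qed

text \<open>Every complementary component of a sphere \<open>T\<close> has \<open>p\<close> on its frontier and so contains one of the
local sides at \<open>p\<close>; as \<open>T\<close> separates the space, the two sides belong to different components.\<close>

lemma components_Compl_two_local_sides:
  fixes T :: "'a::euclidean_space set"
  assumes T: "T homeomorphic sphere (c::'a) 1" and DIM: "2 \<le> DIM('a)"
    and N: "open N" "p \<in> N" "p \<in> T" "N - T = H1 \<union> H2"
    and H: "connected H1" "connected H2" "H1 \<noteq> {}" "H2 \<noteq> {}"
  obtains \<Omega>1 \<Omega>2 where "\<Omega>1 \<noteq> \<Omega>2" "components (- T) = {\<Omega>1, \<Omega>2}" "H1 \<subseteq> \<Omega>1" "H2 \<subseteq> \<Omega>2"
proof -
  have sub: "H1 \<subseteq> - T" "H2 \<subseteq> - T" using N(4) by auto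
  then have ne: "- T \<noteq> {}" using H by auto
  obtain \<Omega>1 where 1: "\<Omega>1 \<in> components (- T)" "H1 \<subseteq> \<Omega>1"
    using exists_component_superset[OF sub(1) ne H(1)] by blast
  obtain \<Omega>2 where 2: "\<Omega>2 \<in> components (- T)" "H2 \<subseteq> \<Omega>2"
    using exists_component_superset[OF sub(2) ne H(2)] by blast
  have "\<Omega> = \<Omega>1 \<or> \<Omega> = \<Omega>2" if \<Omega>: "\<Omega> \<in> components (- T)" for \<Omega>
  proof -
    have "p \<in> closure \<Omega>"
      using Jordan_Brouwer_frontier[OF T \<Omega> DIM] N(3) by (auto simp: frontier_def)
    then have "N \<inter> \<Omega> \<noteq> {}"
      using N(1,2) closure_iff_nhds_not_empty by (metis inf_commute order_refl)
    then have "\<Omega> \<inter> H1 \<noteq> {} \<or> \<Omega> \<inter> H2 \<noteq> {}"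
      using N(4) in_components_subset[OF \<Omega>] by blast
    then have "\<Omega> \<inter> \<Omega>1 \<noteq> {} \<or> \<Omega> \<inter> \<Omega>2 \<noteq> {}"
      using 1(2) 2(2) by blast
    then show ?thesis
      using components_eq[OF \<Omega> 1(1)] components_eq[OF \<Omega> 2(1)] by blast
  qed
  then have comps: "components (- T) = {\<Omega>1, \<Omega>2}" using 1(1) 2(1) by blast
  have "\<Omega>1 \<noteq> \<Omega>2"
  proof
    assume "\<Omega>1 = \<Omega>2"
    then have "- T = \<Omega>1" using Union_components[of "- T"] comps by auto
    then have "connected (- T)" using in_components_connected[OF 1(1)] by simp
    then show False using Jordan_Brouwer_separation[OF T] by simp
  qed
  then show thesis by (rule that[OF _ comps 1(2) 2(2)])
qed

text \<open>Near a point of the common circle, \<open>U\<close> and \<open>V\<close> contain the two halves of \<open>S\<close>, which lie on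
different sides of \<open>T\<close>.\<close>

lemma regions_opposite:
  fixes S T :: "(real^3) set"
  assumes T: "T homeomorphic sphere (0::real^3) 1" and tr: "transversal S T"
    and C: "C \<in> components (S \<inter> T)"
    and U: "U \<in> sides S (S \<inter> T) C" and V: "V \<in> sides S (S \<inter> T) C" and "U \<noteq> V"
  obtains \<Omega> \<Omega>' where "\<Omega> \<noteq> \<Omega>'" "components (- T) = {\<Omega>, \<Omega>'}" "U \<subseteq> \<Omega>" "V \<subseteq> \<Omega>'"
proof -
  obtain p where "p \<in> C" using in_components_nonempty[OF C] by blast
  then have p: "p \<in> S" "p \<in> T" using in_components_subset[OF C] by auto
  obtain N H1 H2 G1 G2 K1 K2 where N: "open N" "p \<in> N"
      "connected H1" "connected H2" "N - T = H1 \<union> H2"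
      "connected G1" "connected G2" "N \<inter> S - T = G1 \<union> G2" "G1 \<subseteq> H1" "G2 \<subseteq> H2"
      "N \<inter> (S \<inter> T) \<subseteq> closure G1 \<inter> closure G2"
      "connected K1" "connected K2" "N \<inter> T - S = K1 \<union> K2"
      "N \<inter> (S \<inter> T) \<subseteq> closure K1 \<inter> closure K2"
    by (rule transversal_local_sides[OF tr p])
  have "p \<in> closure G1" "p \<in> closure G2" using N(2,11) p by auto
  then have G: "G1 \<noteq> {}" "G2 \<noteq> {}" by auto
  then have H: "H1 \<noteq> {}" "H2 \<noteq> {}" using N(9,10) by auto
  obtain \<Omega>1 \<Omega>2 where \<Omega>: "\<Omega>1 \<noteq> \<Omega>2" "components (- T) = {\<Omega>1, \<Omega>2}" "H1 \<subseteq> \<Omega>1" "H2 \<subseteq> \<Omega>2"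
    by (rule components_Compl_two_local_sides[OF T _ N(1,2) p(2) N(5,3,4) H]) simp
  have N8: "N \<inter> S - S \<inter> T = G1 \<union> G2" using N(8) by auto
  have contains: "G1 \<subseteq> W \<or> G2 \<subseteq> W" if "W \<in> sides S (S \<inter> T) C" for W
    using closure_region_local[OF N(1,6,7) G N8 N(11), of W p] that N(2) p \<open>p \<in> C\<close>
    by (auto simp: sides_def)
  have comp: "U \<in> components (S - S \<inter> T)" "V \<in> components (S - S \<inter> T)"
    using U V by (auto simp: sides_def)
  then have disj: "U \<inter> V = {}" using components_nonoverlap \<open>U \<noteq> V\<close> by metis
  have into: "W \<subseteq> \<Omega>" if "W \<in> components (S - S \<inter> T)" "G \<subseteq> W" "G \<noteq> {}" "G \<subseteq> \<Omega>" "\<Omega> \<in> components (- T)"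
    for W G \<Omega>
  proof (rule components_maximal[OF that(5) in_components_connected[OF that(1)]])
    show "W \<subseteq> - T" using in_components_subset[OF that(1)] by blast
    show "\<Omega> \<inter> W \<noteq> {}" using that by blast
  qed
  consider "G1 \<subseteq> U" "G2 \<subseteq> V" | "G2 \<subseteq> U" "G1 \<subseteq> V"
    using contains[OF U] contains[OF V] disj G by blast
  then show thesis
  proof cases
    case 1
    then have "U \<subseteq> \<Omega>1" "V \<subseteq> \<Omega>2"
      using into[OF comp(1)] into[OF comp(2)] G N(9,10) \<Omega> by (metis insertI1 insertI2 order_trans)+
    then show thesis by (rule that[OF \<Omega>(1,2)])
  next
    case 2
    then have "U \<subseteq> \<Omega>2" "V \<subseteq> \<Omega>1"
      using into[OF comp(1)] into[OF comp(2)] G N(9,10) \<Omega> by (metis insertI1 insertI2 order_trans)+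
    moreover have "components (- T) = {\<Omega>2, \<Omega>1}" using \<Omega>(2) by auto
    ultimately show thesis using that[OF \<Omega>(1)[symmetric]] by metis
  qed
qed

lemma closure_region_subset:
  assumes "locally_two_sided S M" "closed S" "M \<subseteq> S" "U \<in> components (S - M)" "x \<in> closure U"
  shows "x \<in> U \<or> (\<exists>C\<in>components M. x \<in> C \<and> U \<in> sides S M C)"
proof (cases "x \<in> M")
  case True
  then obtain C where "C \<in> components M" "x \<in> C" by (rule mem_circle)
  then show ?thesis using region_sides_of_circle[OF assms(1)] assms(4,5) by blast
next
  case False
  have "closure U \<subseteq> S"
    using in_components_subset[OF assms(4)] assms(2) by (intro closure_minimal) auto
  then have "x \<in> closure U \<inter> (S - M)" using False assms(5) by blast
  then show ?thesis using closure_region_Int[OF assms(4)] by simp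
qed

text \<open>The regions other than \<open>D\<close> also accumulate at all other circles, so the union \<open>Y\<close> of their closures
covers everything of \<open>S - c\<close> outside \<open>D\<close>, without meeting \<open>D\<close>. Hence nothing connected in \<open>S - c\<close>
can properly contain \<open>D\<close>.\<close>

lemma leaf_region_component:
  assumes two: "locally_two_sided S M" and "closed S" "M \<subseteq> S" and fin: "finite (components (S - M))"
    and c: "c \<in> components M" and D: "D \<in> sides S M c"
    and leaf: "\<And>C. C \<in> components M \<Longrightarrow> D \<in> sides S M C \<Longrightarrow> C = c"
  shows "D \<in> components (S - c)" "closed (D \<union> c)"
proof -
  have D': "D \<in> components (S - M)" "c \<subseteq> closure D" using D by (auto simp: sides_def)
  have cM: "c \<subseteq> M" using in_components_subset[OF c] .
  have DS: "D \<subseteq> S - M" using in_components_subset[OF D'(1)] .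
  have "closure D \<subseteq> D \<union> c"
    using closure_region_subset[OF two assms(2,3) D'(1)] leaf by blast
  then have clD: "closure D = D \<union> c" using D'(2) closure_subset by blast
  then show "closed (D \<union> c)" by (metis closed_closure)
  define Y where "Y = (\<Union>V\<in>components (S - M) - {D}. closure V)"
  have "closed Y" unfolding Y_def using fin by (intro closed_UN) auto
  have DY: "D \<inter> Y = {}"
  proof -
    have "D \<inter> closure V = {}" if "V \<in> components (S - M)" "V \<noteq> D" for V
      using closure_region_Int[OF that(1)] components_nonoverlap[OF D'(1) that(1)] that(2) DS by blast
    then show ?thesis unfolding Y_def by blast
  qed
  have cover: "S - c \<subseteq> closure D \<union> Y"
  proof
    fix x assume x: "x \<in> S - c"
    show "x \<in> closure D \<union> Y"
    proof (cases "x \<in> M")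
      case True
      then obtain C where C: "C \<in> components M" "x \<in> C" by (rule mem_circle)
      obtain U V where "sides S M C = {U, V}" using sides_eq_pair[OF two C(1)] .
      then have U: "U \<in> sides S M C" by simp
      moreover have "U \<noteq> D" using leaf[OF C(1)] U x C(2) by blast
      ultimately show ?thesis using C(2) unfolding Y_def sides_def by blast
    next
      case False
      then obtain V where "V \<in> components (S - M)" "x \<in> V" using x mem_circle[of x "S - M"] by blast
      then show ?thesis using closure_subset[of V] unfolding Y_def
        by (cases "V = D") blast+
    qed
  qed
  show "D \<in> components (S - c)"
    unfolding in_components_maximal
  proof (intro conjI allI impI)
    show "D \<noteq> {}" "connected D" using in_components_nonempty[OF D'(1)] in_components_connected[OF D'(1)] by auto
    show "D \<subseteq> S - c" using DS cM by blast
    fix X assume X: "X \<noteq> {} \<and> D \<subseteq> X \<and> X \<subseteq> S - c \<and> connected X"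
    have "X \<inter> Y = {} \<or> X \<inter> closure D = {}"
      using connected_closedD[of X Y "closure D"] X cover \<open>closed Y\<close> DY clD by blast
    then have "X \<inter> Y = {}" using X in_components_nonempty[OF D'(1)] closure_subset[of D] by blast
    then show "X = D" using X cover clD by blast
  qed
qed

text \<open>The classes \<open>V1\<close> and \<open>V2\<close> are the two sides of the edge \<open>c\<close> in the tree of \<open>T\<close>: no circle but
\<open>c\<close> joins a region in \<open>V1\<close> to one in \<open>V2\<close>. The unions \<open>X1\<close> and \<open>X2\<close> of closed regions therefore meet
at most in \<open>c\<close>. If \<open>F\<close> reached both a circle \<open>e\<close> on the first side and a circle \<open>f\<close> on the
second, one could get around \<open>A = X1 \<union> D \<union> c\<close>: starting in \<open>F\<close> near \<open>e\<close>, move within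
\<open>F\<close> to \<open>f\<close>, cross \<open>T\<close> there (where \<open>A\<close> is far away), and return to \<open>e\<close> on the other side of \<open>T\<close>.
One can also get around \<open>B = X2 \<union> D \<union> c\<close>, by crossing \<open>T\<close> at \<open>e\<close> directly. As \<open>A \<inter> B\<close> is a closed disc, it
would follow that \<open>A \<union> B\<close>, and hence \<open>T\<close>, does not separate its own two sides. The regions \<open>D\<close> and \<open>F\<close>
are on the same side of \<open>T\<close> because both are neighbors of \<open>K\<close>.\<close>

theorem leaf_disc_does_not_separate:
  fixes S T :: "(real^3) set"
  assumes S: "S homeomorphic sphere (0::real^3) 1" and T: "T homeomorphic sphere (0::real^3) 1"
    and tr: "transversal S T"
    and loops: "\<And>C. C \<in> components (S \<inter> T) \<Longrightarrow>
          \<exists>\<gamma>. simple_path \<gamma> \<and> pathfinish \<gamma> = pathstart \<gamma> \<and> path_image \<gamma> = C"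
    and finS: "finite (components (S - S \<inter> T))" and finT: "finite (components (T - S \<inter> T))"
    and c: "c \<in> components (S \<inter> T)" and Dc: "D \<in> sides S (S \<inter> T) c"
    and leaf: "\<And>C. C \<in> components (S \<inter> T) \<Longrightarrow> D \<in> sides S (S \<inter> T) C \<Longrightarrow> C = c"
    and Kc: "K \<in> sides S (S \<inter> T) c" and "K \<noteq> D"
    and g: "g \<in> components (S \<inter> T)" "K \<in> sides S (S \<inter> T) g" "F \<in> sides S (S \<inter> T) g" and "F \<noteq> K" "F \<noteq> D"
    and V: "V1 \<union> V2 = components (T - S \<inter> T)" "V1 \<inter> V2 = {}"
    and split: "\<And>C. C \<in> components (S \<inter> T) \<Longrightarrow> C \<noteq> c \<Longrightarrow>
          sides T (S \<inter> T) C \<subseteq> V1 \<or> sides T (S \<inter> T) C \<subseteq> V2"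
    and e: "e \<in> components (S \<inter> T)" "e \<noteq> c" "F \<in> sides S (S \<inter> T) e" "sides T (S \<inter> T) e \<subseteq> V1"
    and f: "f \<in> components (S \<inter> T)" "f \<noteq> c" "F \<in> sides S (S \<inter> T) f" "sides T (S \<inter> T) f \<subseteq> V2"
  shows False
proof -
  define M where "M = S \<inter> T"
  note assms = assms[folded M_def]
  note tws = transversal_locally_two_sided[OF tr, folded M_def]
  have MS: "M \<subseteq> S" and MT: "M \<subseteq> T" by (auto simp: M_def)
  have compS: "compact S" using homeomorphic_compactness[OF S] by simp
  have compT: "compact T" using homeomorphic_compactness[OF T] by simp
  have clS: "closed S" and clT: "closed T" using compS compT compact_imp_closed by auto
  have D: "D \<in> components (S - M)" and F: "F \<in> components (S - M)"
    using assms(8,14) by (auto simp: sides_def)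
  have cM: "c \<subseteq> M" using in_components_subset assms(7) .
  have DS: "D \<subseteq> S - M" and FS: "F \<subseteq> S - M"
    using in_components_subset D F by auto
  have DT: "D \<inter> T = {}" and FT: "F \<inter> T = {}" using DS FS by (auto simp: M_def)
  have DF: "D \<inter> F = {}" using components_nonoverlap[OF D F] \<open>F \<noteq> D\<close> by simp
  note leafc = leaf_region_component[OF tws(1) clS MS assms(5,7,8)]
  have Dcomp: "D \<in> components (S - c)" and Dcl: "closed (D \<union> c)"
    using leafc assms(9) by blast+
  obtain \<gamma> where \<gamma>: "simple_path \<gamma>" "pathfinish \<gamma> = pathstart \<gamma>" "path_image \<gamma> = c"
    using assms(4)[OF assms(7)] by blast
  obtain q0 where q0: "q0 \<in> F" using in_components_nonempty[OF F] by blast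
  have AR: "AR (D \<union> c)"
    using AR_closed_disc_in_sphere[OF S \<gamma>(1,2), of D q0] \<gamma>(3) cM MS Dcomp Dcl q0 FS DF by auto
  have subS: "D \<union> c \<subseteq> S" using DS cM MS by blast
  have compD: "compact (D \<union> c)"
    using compS Dcl subS by (metis compact_Int_closed inf.absorb_iff2)

  obtain \<Omega> \<Omega>' where \<Omega>: "\<Omega> \<noteq> \<Omega>'" "components (- T) = {\<Omega>, \<Omega>'}" "D \<subseteq> \<Omega>" "K \<subseteq> \<Omega>'"
    using regions_opposite[OF T tr c Dc Kc] \<open>K \<noteq> D\<close> by metis
  obtain \<Theta> \<Theta>' where \<Theta>: "\<Theta> \<noteq> \<Theta>'" "components (- T) = {\<Theta>, \<Theta>'}" "F \<subseteq> \<Theta>" "K \<subseteq> \<Theta>'"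
    using regions_opposite[OF T tr g(1) g(3) g(2)] \<open>F \<noteq> K\<close> by metis
  have Omc: "\<Omega> \<in> components (- T)" "\<Omega>' \<in> components (- T)" using \<Omega>(2) by auto
  have disj: "\<Omega> \<inter> \<Omega>' = {}" using components_nonoverlap[OF Omc] \<Omega>(1) by simp
  have "K \<noteq> {}" using Kc in_components_nonempty by (auto simp: sides_def)
  have FO: "F \<subseteq> \<Omega>"
  proof -
    have "\<Theta>' \<noteq> \<Omega>" using \<Theta>(4) \<Omega>(4) disj \<open>K \<noteq> {}\<close> by blast
    then have "\<Theta> = \<Omega>" using \<Theta>(1,2) \<Omega>(1,2) by (metis doubleton_eq_iff)
    then show ?thesis using \<Theta>(3) by simp
  qed
  have OT: "\<Omega> \<inter> T = {}" "\<Omega>' \<inter> T = {}" using in_components_subset[OF Omc(1)] in_components_subset[OF Omc(2)] by auto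

  \<comment> \<open>Cutting \<open>T\<close> along \<open>c\<close>.\<close>
  define X1 where "X1 = (\<Union>U\<in>V1. closure U)"
  define X2 where "X2 = (\<Union>U\<in>V2. closure U)"
  have Vsub: "V1 \<subseteq> components (T - M)" "V2 \<subseteq> components (T - M)" using assms(17) by auto
  have finV: "finite V1" "finite V2" using Vsub assms(6) finite_subset by auto
  have clU: "closure U \<subseteq> T" if "U \<in> components (T - M)" for U
    using in_components_subset[OF that] clT by (intro closure_minimal) auto
  have X: "closed X1" "closed X2" "X1 \<subseteq> T" "X2 \<subseteq> T"
    unfolding X1_def X2_def using finV Vsub clU by (auto intro!: closed_UN)
  have compX: "compact X1" "compact X2"
    using compT X by (metis compact_Int_closed inf.absorb_iff2)+
  have cover: "T \<subseteq> X1 \<union> X2"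
  proof
    fix x assume "x \<in> T"
    have "\<exists>U\<in>components (T - M). x \<in> closure U"
    proof (cases "x \<in> M")
      case True
      then obtain C where C: "C \<in> components M" "x \<in> C" by (rule mem_circle)
      obtain U V where "sides T M C = {U, V}" using sides_eq_pair[OF tws(2) C(1)] .
      then have "U \<in> sides T M C" by simp
      then show ?thesis using C(2) by (auto simp: sides_def)
    next
      case False
      then have "x \<in> T - M" using \<open>x \<in> T\<close> by simp
      then obtain U where "U \<in> components (T - M)" "x \<in> U" by (rule mem_circle)
      then show ?thesis using closure_subset by blast
    qed
    then show "x \<in> X1 \<union> X2" using assms(17) unfolding X1_def X2_def by blast
  qed
  have meet: "X1 \<inter> X2 \<subseteq> c"
  proof
    fix x assume "x \<in> X1 \<inter> X2"
    then obtain U1 U2 where U: "U1 \<in> V1" "U2 \<in> V2" "x \<in> closure U1" "x \<in> closure U2"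
      unfolding X1_def X2_def by blast
    have U': "U1 \<in> components (T - M)" "U2 \<in> components (T - M)" "U1 \<noteq> U2" using U Vsub V(2) by auto
    have "x \<in> M"
    proof (rule ccontr)
      assume "x \<notin> M"
      then have "x \<in> U1 \<inter> U2"
        using U(3,4) clU[OF U'(1)] closure_region_Int[OF U'(1)] closure_region_Int[OF U'(2)] by blast
      then show False using components_nonoverlap[OF U'(1,2)] U'(3) by blast
    qed
    then obtain C where C: "C \<in> components M" "x \<in> C" by (rule mem_circle)
    have "U1 \<in> sides T M C" "U2 \<in> sides T M C"
      using region_sides_of_circle[OF tws(2) C] U U' by blast+
    then have "C = c" using assms(19)[OF C(1)] U(1,2) V(2) by blast
    then show "x \<in> c" using C(2) by simp
  qed

  define A where "A = X1 \<union> (D \<union> c)"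
  define B where "B = X2 \<union> (D \<union> c)"
  have cAB: "compact A" "compact B"
    unfolding A_def B_def using compX compD by (simp_all add: compact_Un)
  have "A \<inter> B = D \<union> c"
    using meet DT X(3,4) unfolding A_def B_def by blast
  then have retr: "(A \<inter> B) retract_of UNIV"
    using AR Dcl by (simp add: retract_of_UNIV)
  have near: "p \<notin> X \<union> (D \<union> c)"
    if "C \<in> components M" "C \<noteq> c" "p \<in> C" "X = (\<Union>U\<in>V'. closure U)" "V' \<subseteq> components (T - M)"
      "sides T M C \<inter> V' = {}" for p C X V'
  proof -
    have "p \<in> M" using in_components_subset[OF that(1)] that(3) by blast
    moreover have "p \<notin> c" using components_nonoverlap[OF that(1) assms(7)] that(2,3) by blast
    moreover have "p \<notin> closure U" if "U \<in> V'" for U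
      using region_sides_of_circle[OF tws(2) \<open>C \<in> components M\<close> \<open>p \<in> C\<close>] that
        \<open>V' \<subseteq> components (T - M)\<close> \<open>sides T M C \<inter> V' = {}\<close> by blast
    ultimately show ?thesis using that(4) DS by blast
  qed
  have crossing: "\<exists>a b. a \<in> F \<and> b \<in> \<Omega>' \<and> connected_component (- X) a b"
    if h: "p \<in> C" "C \<in> components M" "F \<in> sides S M C" "p \<notin> X" "closed X" for p C X
  proof -
    obtain r where r: "r > 0" "ball p r \<subseteq> - X"
      using h(4,5) openE[of "- X" p] by (metis ComplI open_Compl)
    have "p \<in> closure F" using h(1,3) by (auto simp: sides_def)
    then obtain a where a: "a \<in> F" "a \<in> ball p r"
      using r(1) by (auto simp: closure_approachable dist_commute)
    have "p \<in> T" using in_components_subset[OF h(2)] h(1) MT by blast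
    then have "p \<in> closure \<Omega>'"
      using Jordan_Brouwer_frontier[OF T Omc(2)] by (auto simp: frontier_def)
    then obtain b where b: "b \<in> \<Omega>'" "b \<in> ball p r"
      using r(1) by (auto simp: closure_approachable dist_commute)
    have "connected_component (- X) a b"
      unfolding connected_component_def using a(2) b(2) r(2) connected_ball by blast
    then show ?thesis using a b by blast
  qed
  \<comment> \<open>The detour around \<open>A\<close> through \<open>F\<close> and \<open>\<Omega>'\<close>, and the direct crossing at \<open>e\<close> that avoids \<open>B\<close>.\<close>
  have ne1: "sides T M e \<inter> V2 = {}" and ne2: "sides T M f \<inter> V1 = {}"
    using assms(23,27) V(2) by blast+
  obtain p where "p \<in> e" using in_components_nonempty[OF e(1)] by blast
  then have "p \<notin> B"
    unfolding B_def using near[OF assms(20,21) _ X2_def Vsub(2) ne1] by blast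
  then obtain a b where ab: "a \<in> F" "b \<in> \<Omega>'" "connected_component (- B) a b"
    using crossing[OF \<open>p \<in> e\<close> assms(20,22)] cAB(2) compact_imp_closed by blast
  obtain q where "q \<in> f" using in_components_nonempty[OF f(1)] by blast
  then have "q \<notin> A"
    unfolding A_def using near[OF assms(24,25) _ X1_def Vsub(1) ne2] by blast
  then obtain a' b' where ab': "a' \<in> F" "b' \<in> \<Omega>'" "connected_component (- A) a' b'"
    using crossing[OF \<open>q \<in> f\<close> assms(24,26)] cAB(1) compact_imp_closed by blast
  have AT: "A \<subseteq> T \<union> D" unfolding A_def using X(3) cM MT by blast
  have "F \<subseteq> - A" using AT FT DF by blast
  then have 1: "connected_component (- A) a a'"
    unfolding connected_component_def using ab(1) ab'(1) in_components_connected[OF F] by blast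
  have "\<Omega>' \<subseteq> - A" using AT OT \<Omega>(3) disj by blast
  then have 2: "connected_component (- A) b' b"
    unfolding connected_component_def using ab(2) ab'(2) in_components_connected[OF Omc(2)] by blast
  have "connected_component (- A) a b"
    using 1 ab'(3) 2 connected_component_trans by metis
  then have "connected_component (- (A \<union> B)) a b"
    using connected_component_Un_retract[OF cAB retr _ _ ab(3)] by simp
  moreover have "- (A \<union> B) \<subseteq> - T" using cover unfolding A_def B_def by blast
  ultimately obtain Y where Y: "connected Y" "Y \<subseteq> - T" "a \<in> Y" "b \<in> Y"
    unfolding connected_component_def by blast
  have "Y \<subseteq> \<Omega>" using components_maximal[OF Omc(1) Y(1,2)] Y(3) ab(1) FO by blast
  then show False using Y(4) ab(2) disj by blast
qed

section \<open>The two trees\<close>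

text \<open>Both trees are rooted at \<open>0\<close>, and an edge is named by its end farther from the root. The edge \<open>1\<close> of the double star is the
central one.\<close>

definition star_parent :: "nat \<Rightarrow> nat" where
  "star_parent i = (if i \<le> 5 then 0 else 1)"

definition leg_parent :: "nat \<Rightarrow> nat" where
  "leg_parent j = (if j mod 3 = 1 then 0 else j - 1)"

text \<open>The legs are \<open>{1, 2, 3}\<close>, \<open>{4, 5, 6}\<close> and \<open>{7, 8, 9}\<close>; the vertices that the edge \<open>j\<close> cuts off
from the root are \<open>{j..leg_end j}\<close>.\<close>

definition leg_end :: "nat \<Rightarrow> nat" where
  "leg_end j = 3 * ((j + 2) div 3)"

lemma one_to_nine: "{1..9::nat} = {1,2,3,4,5,6,7,8,9}"
  by (simp add: atLeastAtMost_insertL numeral_eq_Suc atLeastAtMostSuc_conv insert_commute)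

lemma double_star_edges: "snd double_star_tree = (\<lambda>i. {star_parent i, i}) ` {1..9}"
proof -
  have "{2..5::nat} = {2,3,4,5}" "{6..9::nat} = {6,7,8,9}" by auto
  moreover have "snd double_star_tree =
      {{0,1}} \<union> (\<lambda>i. {0,i}) ` {2..5} \<union> (\<lambda>i. {1,i}) ` {6..9}"
    unfolding double_star_tree_def by (simp only: snd_conv Setcompr_eq_image)
  ultimately show ?thesis
    unfolding one_to_nine by (simp add: star_parent_def insert_commute)
qed

lemma three_paths_edges: "snd three_paths_tree = (\<lambda>j. {leg_parent j, j}) ` {1..9}"
  unfolding one_to_nine by (simp add: three_paths_tree_def leg_parent_def insert_commute)

lemma inj_on_parent_edge:
  fixes par :: "nat \<Rightarrow> nat"
  assumes "\<And>j. j \<in> A \<Longrightarrow> par j < j"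
  shows "inj_on (\<lambda>j. {par j, j}) A"
proof (rule inj_onI)
  fix i j assume "i \<in> A" "j \<in> A" "{par i, i} = {par j, j}"
  then show "i = j"
    using assms[of i] assms[of j] by (auto simp: doubleton_eq_iff)
qed

lemma bij_betw_parent_edges:
  "bij_betw (\<lambda>i. {star_parent i, i}) {1..9} (snd double_star_tree)"
  "bij_betw (\<lambda>j. {leg_parent j, j}) {1..9} (snd three_paths_tree)"
  unfolding double_star_edges three_paths_edges bij_betw_def
  by (auto intro!: inj_on_parent_edge simp: star_parent_def leg_parent_def)

lemma edges_between_vertices_trees:
  "edges_between_vertices double_star_tree" "edges_between_vertices three_paths_tree"
proof -
  have *: "\<exists>u\<in>{0..9}. \<exists>v\<in>{0..9}. {p, j} = {u, v}" if "p \<le> 9" "j \<in> {1..9}" for p j :: nat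
    using that by (intro bexI[of _ p] bexI[of _ j]) auto
  have v: "fst double_star_tree = {0..9}" "fst three_paths_tree = {0..9}"
    by (simp_all add: double_star_tree_def three_paths_tree_def)
  show "edges_between_vertices double_star_tree" "edges_between_vertices three_paths_tree"
    unfolding edges_between_vertices_def double_star_edges three_paths_edges v
    using * by (auto simp: star_parent_def leg_parent_def)
qed

lemma leg_arith:
  assumes "j \<in> {1..9}"
  shows "leg_end j \<in> {3, 6, 9}" "j \<le> leg_end j" "leg_end j - 2 \<le> j"
  using assms unfolding one_to_nine leg_end_def by (elim insertE emptyE; simp)+

lemma leg_end_between:
  assumes "j \<le> k" "k \<le> leg_end j"
  shows "leg_end k = leg_end j"
proof -
  define q where "q = (j + 2) div 3"
  have "k + 2 \<le> 3 * q + 2" using assms(2) by (simp add: leg_end_def q_def)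
  then have "(k + 2) div 3 \<le> (3 * q + 2) div 3" by (rule div_le_mono)
  moreover have "(3 * q + 2) div 3 = q" by simp
  moreover have "q \<le> (k + 2) div 3" unfolding q_def using assms(1) by (intro div_le_mono) simp
  ultimately show ?thesis by (simp add: leg_end_def q_def)
qed

text \<open>In a tree every edge other than \<open>j\<close> stays on one side of \<open>j\<close>.\<close>

lemma leg_split:
  assumes "j \<in> {1..9}" "m \<in> {1..9}" "m \<noteq> j"
  shows "{leg_parent m, m} \<subseteq> {j..leg_end j} \<or> {leg_parent m, m} \<inter> {j..leg_end j} = {}"
proof -
  define q where "q = (j + 2) div 3"
  have end_j: "leg_end j = 3 * q" by (simp add: leg_end_def q_def)
  consider "m < j" | "j < m" "m \<le> 3 * q" | "3 * q < m"
    using assms(3) by linarith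
  then show ?thesis
  proof cases
    case 1
    then show ?thesis by (auto simp: leg_parent_def)
  next
    case 2
    have "m mod 3 \<noteq> 1"
    proof
      assume "m mod 3 = 1"
      then have "m = 3 * (m div 3) + 1" by (metis mult_div_mod_eq)
      then have "(m + 2) div 3 = m div 3 + 1" "m - 1 = 3 * (m div 3)" by linarith+
      moreover have "(m + 2) div 3 = q" 
        using leg_end_between[of j m] 2 end_j by (simp add: leg_end_def)
      moreover have "(j + 2) div 3 \<le> (m - 1 + 2) div 3"
        using 2 by (intro div_le_mono) simp
      ultimately show False by (simp add: q_def)
    qed
    then show ?thesis using 2 end_j by (auto simp: leg_parent_def)
  next
    case 3
    have "leg_parent m = 0 \<or> leg_parent m > 3 * q"
    proof (cases "m mod 3 = 1")
      case False
      then have "m \<noteq> 3 * q + 1" by auto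
      then have "3 * q < m - 1" using 3 by linarith
      then show ?thesis using False by (simp add: leg_parent_def)
    qed (simp add: leg_parent_def)
    then show ?thesis using 3 end_j assms(1) by auto
  qed
qed

text \<open>The predicates \<open>b\<close> and \<open>c\<close> stand for the edges at the two centers of the double star; the one
edge \<open>z\<close> satisfying both is the central edge. Assumptions \<open>B\<close> and \<open>C\<close> say that an edge not at a
center does not separate two edges at that center. With \<open>z\<close> as one of the two, a leg without \<open>z\<close> is
of the kind of its first edge; more than five edges of one kind are impossible, so the two legs without \<open>z\<close> are of different
kinds. With an edge of these two legs as witness, a change of kind is excluded in the leg of \<open>z\<close> too.\<close>

lemma no_unlinked_coloring_of_legs:
  fixes b c :: "nat \<Rightarrow> bool"
  assumes cover: "\<And>j. j \<in> {1..9} \<Longrightarrow> b j \<or> c j"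
    and card: "card {j \<in> {1..9}. b j} = 5" "card {j \<in> {1..9}. c j} = 5"
    and B: "\<And>j k l. \<lbrakk>j \<in> {1..9}; \<not> b j; j < k; k \<le> leg_end j; l \<in> {1..9}; l \<notin> {j..leg_end j};
              b k; b l\<rbrakk> \<Longrightarrow> False"
    and C: "\<And>j k l. \<lbrakk>j \<in> {1..9}; \<not> c j; j < k; k \<le> leg_end j; l \<in> {1..9}; l \<notin> {j..leg_end j};
              c k; c l\<rbrakk> \<Longrightarrow> False"
  shows False
proof -
  let ?b = "{j \<in> {1..9}. b j}" and ?c = "{j \<in> {1..9}. c j}"
  have "?b \<union> ?c = {1..9}" using cover by blast
  moreover have "card (?b \<union> ?c) + card (?b \<inter> ?c) = card ?b + card ?c"
    by (rule card_Un_Int[symmetric]) auto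
  ultimately have "card (?b \<inter> ?c) = 1" using card by simp
  then obtain z where z: "?b \<inter> ?c = {z}" by (rule card_1_singletonE)
  then have z': "z \<in> {1..9}" "b z" "c z" by auto
  have only: "\<not> (b j \<and> c j)" if "j \<in> {1..9}" "j \<noteq> z" for j
    using that z by blast
  have few: False if "X \<subseteq> {1..9}" "card X \<ge> 6" "(\<forall>j\<in>X. b j) \<or> (\<forall>j\<in>X. c j)" for X
  proof -
    have "X \<subseteq> ?b \<or> X \<subseteq> ?c" using that by blast
    then have "card X \<le> 5"
      using card card_mono[of ?b X] card_mono[of ?c X] by auto
    then show False using that by simp
  qed
  have out: "l \<notin> {j..leg_end j}" if "leg_end l \<noteq> leg_end j" for j l
    using leg_end_between[of j l] that by auto
  have mono: "(b j \<longrightarrow> b k) \<and> (c j \<longrightarrow> c k)"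
    if "j \<in> {1..9}" "j < k" "k \<le> leg_end j" "leg_end j \<noteq> leg_end z" for j k
  proof -
    have "k \<in> {1..9}" using that leg_arith(1)[OF that(1)] by auto
    moreover have "j \<noteq> z" using that by auto
    ultimately show ?thesis
      using B[OF that(1) _ that(2,3) z'(1) out] C[OF that(1) _ that(2,3) z'(1) out]
        only[OF that(1)] cover[of k] z'(2,3) that(4)[symmetric] by blast
  qed
  have leg: "(\<forall>j\<in>{s-2..s}. b j) \<or> (\<forall>j\<in>{s-2..s}. c j)" if "s \<in> {3,6,9}" "s \<noteq> leg_end z" for s
  proof -
    have s: "leg_end (s - 2) = s" "s - 2 \<in> {1..9}" using that by (auto simp: leg_end_def)
    have "(b (s-2) \<longrightarrow> b k) \<and> (c (s-2) \<longrightarrow> c k)" if "k \<in> {s-2..s}" for k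
      using mono[OF s(2), of k] that s(1) \<open>s \<noteq> leg_end z\<close> by (cases "k = s - 2") auto
    then show ?thesis using cover[OF s(2)] by blast
  qed
  have "\<exists>s t. s \<in> {3,6,9} \<and> t \<in> {3,6,9} \<and> s \<noteq> t \<and> s \<noteq> leg_end z \<and> t \<noteq> leg_end z"
  proof -
    consider "leg_end z = 3" | "leg_end z = 6" | "leg_end z = 9"
      using leg_arith(1)[OF z'(1)] by blast
    then show ?thesis
    proof cases
      case 1 then show ?thesis by (intro exI[of _ 6] exI[of _ 9]) simp
    next
      case 2 then show ?thesis by (intro exI[of _ 3] exI[of _ 9]) simp
    next
      case 3 then show ?thesis by (intro exI[of _ 3] exI[of _ 6]) simp
    qed
  qed
  then obtain s t where st: "s \<in> {3,6,9}" "t \<in> {3,6,9}" "s \<noteq> t" "s \<noteq> leg_end z" "t \<noteq> leg_end z"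
    by blast
  have two_legs: "card ({s-2..s} \<union> {t-2..t}) = 6" "{s-2..s} \<union> {t-2..t} \<subseteq> {1..9}"
    if "s \<in> {3,6,9}" "t \<in> {3,6,9}" "s \<noteq> t" for s t :: nat
  proof -
    have "{s-2..s} \<inter> {t-2..t} = {}" using that by auto
    then show "card ({s-2..s} \<union> {t-2..t}) = 6" using that by (subst card_Un_disjoint) auto
    show "{s-2..s} \<union> {t-2..t} \<subseteq> {1..9}" using that by auto
  qed
  have mixed: "\<not> ((\<forall>j\<in>{s-2..s}. b j) \<and> (\<forall>j\<in>{t-2..t}. b j))"
    "\<not> ((\<forall>j\<in>{s-2..s}. c j) \<and> (\<forall>j\<in>{t-2..t}. c j))"
    if "s \<in> {3,6,9}" "t \<in> {3,6,9}" "s \<noteq> t" for s t :: nat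
    using few[OF two_legs(2)[OF that]] two_legs(1)[OF that] by (simp_all only: ball_Un) blast+
  obtain s t where s: "s \<in> {3,6,9}" "s \<noteq> leg_end z" "\<forall>j\<in>{s-2..s}. b j"
    and t: "t \<in> {3,6,9}" "t \<noteq> leg_end z" "\<forall>j\<in>{t-2..t}. c j"
  proof (cases "\<forall>j\<in>{s-2..s}. b j")
    case True
    then have "\<forall>j\<in>{t-2..t}. c j" using leg[OF st(2,5)] mixed(1)[OF st(1-3)] by blast
    then show thesis using that[OF st(1,4) True st(2,5)] by simp
  next
    case False
    then have Q: "\<forall>j\<in>{s-2..s}. c j" using leg[OF st(1,4)] by blast
    then have "\<forall>j\<in>{t-2..t}. b j" using leg[OF st(2,5)] mixed(2)[OF st(1-3)] by blast
    then show thesis using that[OF st(2,5) _ st(1,4) Q] by simp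
  qed
  have s': "b s" "s \<in> {1..9}" "leg_end s = s" and t': "c t" "t \<in> {1..9}" "leg_end t = t"
    using s t by (auto simp: leg_end_def)
  have after: "(b j \<longrightarrow> \<not> c k) \<and> (c j \<longrightarrow> \<not> b k)"
    if "j \<in> {1..9}" "j < k" "k \<le> leg_end j" "leg_end j = leg_end z" "j \<noteq> z" for j k
  proof -
    have "s \<notin> {j..leg_end j}" "t \<notin> {j..leg_end j}"
      using out[of s j] out[of t j] s'(3) t'(3) s(2) t(2) that(4) by simp_all
    then show ?thesis
      using B[OF that(1) _ that(2,3) s'(2) _ _ s'(1)] C[OF that(1) _ that(2,3) t'(2) _ _ t'(1)]
        only[OF that(1,5)] by blast
  qed
  let ?e = "leg_end z"
  have e: "?e - 2 \<in> {1..9}" "leg_end (?e - 2) = ?e" "?e \<in> {3,6,9}" "z \<le> ?e" "?e - 2 \<le> z"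
    using leg_arith[OF z'(1)] by (auto simp: leg_end_def)
  \<comment> \<open>Since \<open>z\<close> is of both kinds, any edge before it would be followed by a change of kind.\<close>
  have z_first: "z = ?e - 2"
  proof (rule ccontr)
    assume "z \<noteq> ?e - 2"
    then have "?e - 2 < z" using e(5) by simp
    then show False
      using after[OF e(1) _ _ e(2)] e(2,4) z' cover[OF e(1)] by force
  qed
  have u: "z + 1 \<in> {1..9}" "z + 2 \<in> {1..9}" "leg_end (z + 1) = ?e" "z + 2 = ?e"
    using z_first e(3) by (auto simp: leg_end_def)
  have "(b (z+1) \<longrightarrow> \<not> c (z+2)) \<and> (c (z+1) \<longrightarrow> \<not> b (z+2))"
    using after[OF u(1), of "z+2"] u by simp
  then have "(b (z+1) \<and> b (z+2)) \<or> (c (z+1) \<and> c (z+2))"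
    using cover[OF u(1)] cover[OF u(2)] by blast
  moreover have "{?e-2..?e} = {z, z+1, z+2}"
    using u(4) z_first by auto
  ultimately have "(\<forall>j\<in>{?e-2..?e}. b j) \<or> (\<forall>j\<in>{?e-2..?e}. c j)"
    using z' by auto
  then show False
    using mixed(1)[OF s(1) e(3) s(2)] mixed(2)[OF t(1) e(3) t(2)] s(3) t(3) by blast
qed

section \<open>The obstruction\<close>

lemma card_Collect_bij_betw:
  assumes "bij_betw \<tau> A B"
  shows "card {j \<in> A. P (\<tau> j)} = card {i \<in> B. P i}"
proof -
  have "\<tau> ` {j \<in> A. P (\<tau> j)} = {i \<in> B. P i}"
    using assms by (auto simp: bij_betw_def)
  moreover have "inj_on \<tau> {j \<in> A. P (\<tau> j)}"
    using assms by (auto simp: bij_betw_def inj_on_def)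
  ultimately show ?thesis using card_image by metis
qed

text \<open>\<open>Q j\<close> is the circle with label \<open>j\<close> in the tree of \<open>T\<close>, and \<open>\<tau> j\<close> is the label of the same circle
in the tree of \<open>S\<close>. The two families of edges fed to \<open>no_unlinked_coloring_of_legs\<close> are those \<open>j\<close> for which the circle \<open>Q j\<close>
borders the region labelled \<open>0\<close>, respectively \<open>1\<close>.\<close>

lemma no_transversal_double_star_three_paths:
  fixes S T :: "(real^3) set"
  assumes S: "S homeomorphic sphere (0::real^3) 1" and T: "T homeomorphic sphere (0::real^3) 1"
    and tr: "transversal S T" and circles: "union_of_disjoint_circles 9 (S \<inter> T)"
    and isoS: "graph_isomorphic (dual_graph S (S \<inter> T)) double_star_tree"
    and isoT: "graph_isomorphic (dual_graph T (S \<inter> T)) three_paths_tree"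
  shows False
proof -
  define M where "M = S \<inter> T"
  note M = union_of_disjoint_circles_components[OF circles, folded M_def]
  note two = transversal_locally_two_sided[OF tr, folded M_def]
  let ?star = "\<lambda>i. {star_parent i, i}" and ?leg = "\<lambda>j. {leg_parent j, j}"
  have cards: "card (snd double_star_tree) = card (components M)"
    "card (snd three_paths_tree) = card (components M)"
    using bij_betw_same_card[OF bij_betw_parent_edges(1)]
      bij_betw_same_card[OF bij_betw_parent_edges(2)] M(2) by simp_all
  obtain \<phi> where \<phi>: "bij_betw \<phi> (components (S - M)) (fst double_star_tree)"
    and \<alpha>: "bij_betw (\<lambda>C. \<phi> ` sides S M C) (components M) (snd double_star_tree)"
    by (rule circle_labelling[OF two(1) M(1) isoS[folded M_def] edges_between_vertices_trees(1) cards(1)])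
  obtain \<psi> where \<psi>: "bij_betw \<psi> (components (T - M)) (fst three_paths_tree)"
    and \<beta>: "bij_betw (\<lambda>C. \<psi> ` sides T M C) (components M) (snd three_paths_tree)"
    by (rule circle_labelling[OF two(2) M(1) isoT[folded M_def] edges_between_vertices_trees(2) cards(2)])
  have verts: "fst double_star_tree = {0..9}" "fst three_paths_tree = {0..9}"
    by (simp_all add: double_star_tree_def three_paths_tree_def)
  have finS: "finite (components (S - M))" and finT: "finite (components (T - M))"
    using bij_betw_finite[OF \<phi>] bij_betw_finite[OF \<psi>] verts by simp_all

  define Q where "Q = (\<lambda>j. inv_into (components M) (\<lambda>C. \<psi> ` sides T M C) (?leg j))"
  have Q: "bij_betw Q {1..9} (components M)"
    using bij_betw_trans[OF bij_betw_parent_edges(2) bij_betw_inv_into[OF \<beta>]]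
    by (simp add: Q_def comp_def)
  have Q_leg: "\<psi> ` sides T M (Q j) = ?leg j" if "j \<in> {1..9}" for j
    unfolding Q_def using bij_betw_inv_into_right[OF \<beta>] bij_betwE[OF bij_betw_parent_edges(2)] that by blast
  define \<tau> where "\<tau> = (\<lambda>j. inv_into {1..9} ?star (\<phi> ` sides S M (Q j)))"
  have \<tau>: "bij_betw \<tau> {1..9} {1..9}"
    using bij_betw_trans[OF bij_betw_trans[OF Q \<alpha>] bij_betw_inv_into[OF bij_betw_parent_edges(1)]]
    by (simp add: \<tau>_def comp_def)
  have \<tau>_in: "\<tau> j \<in> {1..9}" if "j \<in> {1..9}" for j
    using bij_betwE[OF \<tau>] that by blast
  have Q_in: "Q j \<in> components M" if "j \<in> {1..9}" for j
    using bij_betwE[OF Q] that by blast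
  have Q_star: "\<phi> ` sides S M (Q j) = ?star (\<tau> j)" if "j \<in> {1..9}" for j
  proof -
    have "\<phi> ` sides S M (Q j) \<in> snd double_star_tree"
      using bij_betwE[OF \<alpha>] Q_in[OF that] by blast
    then show ?thesis
      unfolding \<tau>_def using bij_betw_inv_into_right[OF bij_betw_parent_edges(1)] by simp
  qed
  have mem_sides: "X \<in> sides S M (Q j) \<longleftrightarrow> \<phi> X \<in> ?star (\<tau> j)"
    if "X \<in> components (S - M)" "j \<in> {1..9}" for X j
  proof -
    have "sides S M (Q j) \<subseteq> components (S - M)" by (auto simp: sides_def)
    then have "\<phi> X \<in> \<phi> ` sides S M (Q j) \<longleftrightarrow> X \<in> sides S M (Q j)"
      using inj_on_image_mem_iff[OF bij_betw_imp_inj_on[OF \<phi>] that(1)] by blast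
    then show ?thesis using Q_star[OF that(2)] by simp
  qed
  have region: "\<exists>X\<in>components (S - M). \<phi> X = i" if "i \<le> 9" for i
  proof -
    have "i \<in> \<phi> ` components (S - M)"
      using bij_betw_imp_surj_on[OF \<phi>] verts(1) that by simp
    then show ?thesis by blast
  qed

  \<comment> \<open>An edge \<open>\<tau> j\<close> not at the center \<open>w\<close> ends in a leaf \<open>D\<close> at the other center \<open>v\<close>. The region \<open>K\<close>
    labelled \<open>v\<close> is a neighbor of \<open>D\<close> and, across the central circle \<open>Q m1\<close>, of the region \<open>F\<close> labelled \<open>w\<close>.\<close>
  have unlinked: False
    if w: "w \<in> {0, 1}" and j: "j \<in> {1..9}" "w \<notin> ?star (\<tau> j)"
      and k: "j < k" "k \<le> leg_end j" "w \<in> ?star (\<tau> k)"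
      and l: "l \<in> {1..9}" "l \<notin> {j..leg_end j}" "w \<in> ?star (\<tau> l)" for w j k l
  proof -
    have k19: "k \<in> {1..9}" using k leg_arith(1)[OF j(1)] j(1) by auto
    define i where "i = \<tau> j"
    define v where "v = star_parent i"
    have "i \<noteq> 1" using j(2) w by (auto simp: i_def star_parent_def)
    then have i: "2 \<le> i" "i \<le> 9" using \<tau>_in[OF j(1)] by (auto simp: i_def)
    have v: "v \<in> {0, 1}" "v \<noteq> w" using j(2) by (auto simp: v_def i_def star_parent_def)
    obtain D where D: "D \<in> components (S - M)" "\<phi> D = i" using region[OF i(2)] by blast
    obtain K where K: "K \<in> components (S - M)" "\<phi> K = v" using region[of v] v(1) by auto
    obtain F where F: "F \<in> components (S - M)" "\<phi> F = w" using region[of w] w by auto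
    have "1 \<in> \<tau> ` {1..9}" using bij_betw_imp_surj_on[OF \<tau>] by simp
    then obtain m1 where m1: "m1 \<in> {1..9}" "\<tau> m1 = 1" by force
    define W where "W = {j..leg_end j}"
    define V1 where "V1 = {U \<in> components (T - M). \<psi> U \<in> W}"
    define V2 where "V2 = {U \<in> components (T - M). \<psi> U \<notin> W}"
    have sidesV: "sides T M (Q m) \<subseteq> V1" if "m \<in> {1..9}" "?leg m \<subseteq> W" for m
      using Q_leg[OF that(1)] that(2) unfolding V1_def sides_def by blast
    have sidesV': "sides T M (Q m) \<subseteq> V2" if "m \<in> {1..9}" "?leg m \<inter> W = {}" for m
      using Q_leg[OF that(1)] that(2) unfolding V2_def sides_def by blast
    have ne: "k \<noteq> j" "l \<noteq> j" using k l leg_arith(2)[OF j(1)] by auto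
    have Qne: "Q m \<noteq> Q j" if "m \<in> {1..9}" "m \<noteq> j" for m
      using bij_betw_imp_inj_on[OF Q] that j(1) by (auto dest: inj_onD)
    show False
    proof (rule leaf_disc_does_not_separate[OF S T tr, folded M_def, where c = "Q j" and D = D and K = K
          and g = "Q m1" and F = F and ?V1.0 = V1 and ?V2.0 = V2 and e = "Q k" and f = "Q l"])
      show "\<exists>\<gamma>. simple_path \<gamma> \<and> pathfinish \<gamma> = pathstart \<gamma> \<and> path_image \<gamma> = C"
        if "C \<in> components M" for C
        using pl_circle_imp_simple_loop[OF M(3)[OF that]] by metis
      show "finite (components (S - M))" "finite (components (T - M))" by fact+
      show "Q j \<in> components M" "Q m1 \<in> components M" "Q k \<in> components M" "Q l \<in> components M"
        using Q_in j m1 k19 l by blast+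
      show "D \<in> sides S M (Q j)" "K \<in> sides S M (Q j)"
        using mem_sides[OF D(1) j(1)] mem_sides[OF K(1) j(1)] D(2) K(2) by (simp_all add: i_def v_def)
      show "C = Q j" if C: "C \<in> components M" "D \<in> sides S M C" for C
      proof -
        obtain m where m: "m \<in> {1..9}" "C = Q m" using bij_betw_imp_surj_on[OF Q] C(1) by blast
        then have "i \<in> ?star (\<tau> m)" using mem_sides[OF D(1) m(1)] C(2) D(2) by simp
        then have "\<tau> m = \<tau> j" using i(1) by (auto simp: star_parent_def i_def split: if_splits)
        then have "m = j" using bij_betw_imp_inj_on[OF \<tau>] m(1) j(1) by (auto dest: inj_onD)
        then show ?thesis using m(2) by simp
      qed
      show "K \<noteq> D" "F \<noteq> K" "F \<noteq> D" using D(2) K(2) F(2) i(1) v w by auto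
      show "K \<in> sides S M (Q m1)" "F \<in> sides S M (Q m1)"
        using mem_sides[OF K(1) m1(1)] mem_sides[OF F(1) m1(1)] K(2) F(2) m1(2) v(1) w
        by (auto simp: star_parent_def)
      show "V1 \<union> V2 = components (T - M)" "V1 \<inter> V2 = {}" by (auto simp: V1_def V2_def)
      show "sides T M C \<subseteq> V1 \<or> sides T M C \<subseteq> V2" if C: "C \<in> components M" "C \<noteq> Q j" for C
      proof -
        obtain m where m: "m \<in> {1..9}" "C = Q m" using bij_betw_imp_surj_on[OF Q] C(1) by blast
        moreover have "m \<noteq> j" using m C(2) by auto
        ultimately show ?thesis
          using leg_split[OF j(1) m(1)] sidesV[OF m(1)] sidesV'[OF m(1)] unfolding W_def by blast
      qed
      show "Q k \<noteq> Q j" "Q l \<noteq> Q j" using Qne k19 l(1) ne by blast+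
      show "F \<in> sides S M (Q k)" "F \<in> sides S M (Q l)"
        using mem_sides[OF F(1) k19] mem_sides[OF F(1) l(1)] F(2) k(3) l(3) by simp_all
      have "k \<in> W" "l \<notin> W" using k l by (auto simp: W_def)
      then have "?leg k \<subseteq> W" "?leg l \<inter> W = {}"
        using leg_split[OF j(1) k19 ne(1)] leg_split[OF j(1) l(1) ne(2)] unfolding W_def by blast+
      then show "sides T M (Q k) \<subseteq> V1" "sides T M (Q l) \<subseteq> V2"
        using sidesV[OF k19] sidesV'[OF l(1)] by blast+
    qed
  qed

  have "{i \<in> {1..9}. 0 \<in> ?star i} = {1..5}" "{i \<in> {1..9}. 1 \<in> ?star i} = insert 1 {6..9}"
    by (auto simp: star_parent_def)
  then have "card {j \<in> {1..9}. 0 \<in> ?star (\<tau> j)} = 5" "card {j \<in> {1..9}. 1 \<in> ?star (\<tau> j)} = 5"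
    using card_Collect_bij_betw[OF \<tau>, of "\<lambda>i. 0 \<in> ?star i"]
      card_Collect_bij_betw[OF \<tau>, of "\<lambda>i. 1 \<in> ?star i"] by simp_all
  moreover have "0 \<in> ?star (\<tau> j) \<or> 1 \<in> ?star (\<tau> j)" for j
    by (auto simp: star_parent_def)
  ultimately show False
    using no_unlinked_coloring_of_legs[of "\<lambda>j. 0 \<in> ?star (\<tau> j)" "\<lambda>j. 1 \<in> ?star (\<tau> j)"]
      unlinked[of 0] unlinked[of 1] by blast
qed

theorem theorem1:
  fixes M N :: "(real^3) set"
  assumes "M \<subseteq> S2" and "union_of_disjoint_circles 9 M"
    and "N \<subseteq> S2" and "union_of_disjoint_circles 9 N"
    and "graph_isomorphic (dual_graph S2 M) double_star_tree"
    and "graph_isomorphic (dual_graph S2 N) three_paths_tree"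
  shows "\<not> (\<exists>S S' :: (real^3) set.
            pl_sphere S \<and> pl_sphere S' \<and>
            transversal S S' \<and>
            union_of_disjoint_circles 9 (S \<inter> S') \<and>
            situated_as (S \<inter> S') S M S2 \<and>
            situated_as (S \<inter> S') S' N S2)"
proof
  assume "\<exists>S S' :: (real^3) set. pl_sphere S \<and> pl_sphere S' \<and> transversal S S' \<and>
            union_of_disjoint_circles 9 (S \<inter> S') \<and>
            situated_as (S \<inter> S') S M S2 \<and> situated_as (S \<inter> S') S' N S2"
  then obtain S S' :: "(real^3) set" where S: "pl_sphere S" "pl_sphere S'" and tr: "transversal S S'"
    and circles: "union_of_disjoint_circles 9 (S \<inter> S')"
    and M: "situated_as (S \<inter> S') S M S2" and N: "situated_as (S \<inter> S') S' N S2"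
    by blast
  note sph = pl_sphere_homeomorphic_sphere[OF S(1)] pl_sphere_homeomorphic_sphere[OF S(2)]
  have compact: "compact S" "compact S'" "compact S2"
    using homeomorphic_compactness[OF sph(1)] homeomorphic_compactness[OF sph(2)]
      homeomorphic_compactness[OF S2_homeomorphic_sphere] by simp_all
  have transport: "graph_isomorphic (dual_graph X Z) (dual_graph S2 Y)"
    if "situated_as Z X Y S2" "compact X" "Z \<subseteq> X" for X Y Z
    using that homeomorphism_graph_isomorphic_dual_graph[OF _ that(2) compact(3) that(3)]
    unfolding situated_as_def pl_homeomorphism_def by blast
  show False
    using no_transversal_double_star_three_paths[OF sph tr circles]
      graph_isomorphic_trans[OF transport[OF M compact(1)] assms(5)]
      graph_isomorphic_trans[OF transport[OF N compact(2)] assms(6)] by simp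
qed

end
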